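(* Let $S=\mathbb{S}^{d-1}$ be the sphere in $\mathbb{R}^d$ and let $\sigma$ be the surface measure on $\mathbb{S}^{d-1}$. Let $\mu$ be a complex measure on Borel subsets of $\mathbb{R}^d$ whose Fourier transform $\widehat{\mu}$ is a $\mathrm{C}^\infty$ function satisfying $|\nabla\widehat{\mu}(x)| \leq D (1+|x|)^{-1-\eta}$ for each $x\in\mathbb{R}^d$, with a constant $D\in[0,\infty)$ and a parameter $\eta\in(0,\infty)$. Let $p\in[1,2]$ satisfy $p\leq \frac{2(d+1)}{d+3}$ and let $q=2$. Then the maximal estimate $$\Big\| \sup_{t\in(0,\infty)} \big| \widehat{f}\ast\mu_t \big| \Big\|_{L^2(\mathbb{S}^{d-1},\sigma)} \lesssim_{p,\eta} C_{\mathrm{restr}}\, D\, \|f\|_{L^p(\mathbb{R}^d)}$$ holds for every Schwartz function $f$ on $\mathbb{R}^d$, where $C_{\mathrm{restr}}$ is a finite constant for which the restriction estimate $\|\widehat f\,\|_{L^2(\mathbb{S}^{d-1},\sigma)}\le C_{\mathrm{restr}}\|f\|_{L^p(\mathbb{R}^d)}$ holds for every Schwartz function $f$ on $\mathbb{R}^d$ (such a constant exists by the Tomas–Stein theorem).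
   Context: The notation $A\lesssim_{P}B$ means that $A\leq C_P B$ with a constant $C_P\in[0,\infty)$ depending only on the parameters in $P$. A complex measure is finite by definition. Schwartz functions are complex-valued. For an integrable function $f$ on $\mathbb{R}^d$, $\widehat{f}(y)=\int_{\mathbb{R}^d}e^{-2\pi i x\cdot y}f(x)\,dx$, and for a complex Borel measure $\mu$, $\widehat{\mu}(y)=\int_{\mathbb{R}^d}e^{-2\pi i x\cdot y}\,d\mu(x)$. For $t\in(0,\infty)$, $\mu_t(E):=\mu(t^{-1}E)$ for Borel $E\subseteq\mathbb{R}^d$. Convolution: $(g\ast\mu)(x)=\int_{\mathbb{R}^d}g(x-y)\,d\mu(y)$. $|x|$ is the Euclidean length. In $L^2(\mathbb{S}^{d-1},\sigma)$-norms, functions on $\mathbb{R}^d$ are restricted to the sphere.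
   Formalization: The formal theorem additionally assumes that the Fourier transform of μ tends to 0 at infinity (equivalently μ({0})=0); without this the claim fails, e.g. for μ=δ_0 with D=0, where it would give ‖f̂‖_{L²(S,σ)} ≤ 0. *)

theory Defs
  imports "HOL-Analysis.Analysis"
begin

text \<open>
  The dimension is an ordinary natural number, so that constants can be quantified before it.
  Points of d-dimensional Euclidean space are the functions in
  \<open>extensional {..<d}\<close>, the space of the product measure \<open>Pi\<^sub>M {..<d}\<close>;
  their topology is the product topology of \<^typ>\<open>nat \<Rightarrow> real\<close>, which induces the
  Euclidean one.
\<close>

definition Rd :: "nat \<Rightarrow> (nat \<Rightarrow> real) set" where
  "Rd d = (\<Pi>\<^sub>E i\<in>{..<d}. UNIV)"

definition leb :: "nat \<Rightarrow> (nat \<Rightarrow> real) measure" where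
  "leb d = Pi\<^sub>M {..<d} (\<lambda>_. lborel)"

definition dot :: "nat \<Rightarrow> (nat \<Rightarrow> real) \<Rightarrow> (nat \<Rightarrow> real) \<Rightarrow> real" where
  "dot d x y = (\<Sum>i<d. x i * y i)"

definition enorm :: "nat \<Rightarrow> (nat \<Rightarrow> real) \<Rightarrow> real" where
  "enorm d x = L2_set x {..<d}"

definition vscale :: "nat \<Rightarrow> real \<Rightarrow> (nat \<Rightarrow> real) \<Rightarrow> (nat \<Rightarrow> real)" where
  "vscale d t x = (\<lambda>i\<in>{..<d}. t * x i)"

definition vminus :: "nat \<Rightarrow> (nat \<Rightarrow> real) \<Rightarrow> (nat \<Rightarrow> real) \<Rightarrow> (nat \<Rightarrow> real)" where
  "vminus d x y = (\<lambda>i\<in>{..<d}. x i - y i)"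

text \<open>Partial derivatives, smoothness and Schwartz functions.\<close>

definition pderivative :: "nat \<Rightarrow> ((nat \<Rightarrow> real) \<Rightarrow> complex) \<Rightarrow> (nat \<Rightarrow> real) \<Rightarrow> complex" where
  "pderivative i f x = vector_derivative (\<lambda>s. f (x(i := s))) (at (x i))"

definition iter_pderivative ::
    "nat list \<Rightarrow> ((nat \<Rightarrow> real) \<Rightarrow> complex) \<Rightarrow> (nat \<Rightarrow> real) \<Rightarrow> complex" where
  "iter_pderivative is f = foldr pderivative is f"

text \<open>
  All iterated partial derivatives exist and are continuous.  The differentiability clause is
  needed because \<^const>\<open>vector_derivative\<close> is total.
\<close>
definition smooth :: "nat \<Rightarrow> ((nat \<Rightarrow> real) \<Rightarrow> complex) \<Rightarrow> bool" where
  "smooth d f \<longleftrightarrow>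
     (\<forall>is. set is \<subseteq> {..<d} \<longrightarrow>
        continuous_on (Rd d) (iter_pderivative is f) \<and>
        (\<forall>x\<in>Rd d. \<forall>i<d. (\<lambda>s. iter_pderivative is f (x(i := s))) differentiable (at (x i))))"

definition schwartz :: "nat \<Rightarrow> ((nat \<Rightarrow> real) \<Rightarrow> complex) \<Rightarrow> bool" where
  "schwartz d f \<longleftrightarrow> smooth d f \<and>
     (\<forall>is N. set is \<subseteq> {..<d} \<longrightarrow>
        (\<exists>B. \<forall>x\<in>Rd d. enorm d x ^ N * cmod (iter_pderivative is f x) \<le> B))"

definition grad_norm :: "nat \<Rightarrow> ((nat \<Rightarrow> real) \<Rightarrow> complex) \<Rightarrow> (nat \<Rightarrow> real) \<Rightarrow> real" where
  "grad_norm d f x = L2_set (\<lambda>i. cmod (pderivative i f x)) {..<d}"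

text \<open>
  A complex measure on the measurable sets of \<open>M\<close> is a countably additive complex set function;
  only the \<sigma>-algebra of \<open>M\<close> matters.
\<close>
definition complex_measure :: "'a measure \<Rightarrow> ('a set \<Rightarrow> complex) \<Rightarrow> bool" where
  "complex_measure M \<mu> \<longleftrightarrow>
     (\<forall>A :: nat \<Rightarrow> 'a set. range A \<subseteq> sets M \<longrightarrow> disjoint_family A \<longrightarrow>
        (\<lambda>n. \<mu> (A n)) sums \<mu> (\<Union>n. A n))"

text \<open>
  The positive part in the Jordan decomposition of a finite signed measure \<open>\<nu>\<close>; the negative part
  is the positive part of \<open>-\<nu>\<close>.  \<^const>\<open>ennreal\<close> sends negative values to 0, which does not
  affect the supremum since \<open>A = {}\<close> is admissible.
\<close>
definition pos_part :: "'a measure \<Rightarrow> ('a set \<Rightarrow> real) \<Rightarrow> 'a measure" where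
  "pos_part M \<nu> = measure_of (space M) (sets M)
     (\<lambda>E. SUP A\<in>{A \<in> sets M. A \<subseteq> E}. ennreal (\<nu> A))"

definition signed_integral :: "'a measure \<Rightarrow> ('a set \<Rightarrow> real) \<Rightarrow> ('a \<Rightarrow> complex) \<Rightarrow> complex" where
  "signed_integral M \<nu> g =
     (\<integral>x. g x \<partial>pos_part M \<nu>) - (\<integral>x. g x \<partial>pos_part M (\<lambda>A. - \<nu> A))"

definition complex_integral ::
    "'a measure \<Rightarrow> ('a set \<Rightarrow> complex) \<Rightarrow> ('a \<Rightarrow> complex) \<Rightarrow> complex" where
  "complex_integral M \<mu> g =
     signed_integral M (\<lambda>A. Re (\<mu> A)) g + \<i> * signed_integral M (\<lambda>A. Im (\<mu> A)) g"

definition fourier :: "nat \<Rightarrow> ((nat \<Rightarrow> real) \<Rightarrow> complex) \<Rightarrow> (nat \<Rightarrow> real) \<Rightarrow> complex" where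
  "fourier d f y = (\<integral>x. exp (- 2 * of_real pi * \<i> * of_real (dot d x y)) * f x \<partial>leb d)"

definition fourier_measure ::
    "nat \<Rightarrow> ((nat \<Rightarrow> real) set \<Rightarrow> complex) \<Rightarrow> (nat \<Rightarrow> real) \<Rightarrow> complex" where
  "fourier_measure d \<mu> y =
     complex_integral (leb d) \<mu> (\<lambda>x. exp (- 2 * of_real pi * \<i> * of_real (dot d x y)))"

definition dilate ::
    "nat \<Rightarrow> real \<Rightarrow> ((nat \<Rightarrow> real) set \<Rightarrow> complex) \<Rightarrow> (nat \<Rightarrow> real) set \<Rightarrow> complex" where
  "dilate d t \<mu> E = \<mu> (vscale d (inverse t) ` E)"

definition convolution ::
    "nat \<Rightarrow> ((nat \<Rightarrow> real) \<Rightarrow> complex) \<Rightarrow> ((nat \<Rightarrow> real) set \<Rightarrow> complex) \<Rightarrow>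
     (nat \<Rightarrow> real) \<Rightarrow> complex" where
  "convolution d g \<mu> x = complex_integral (leb d) \<mu> (\<lambda>y. g (vminus d x y))"

text \<open>
  Surface measure on the unit sphere, as a measure on the ambient space concentrated on the sphere:
  \<open>\<sigma> E = d * Leb {r u | u \<in> E, |u| = 1, 0 < r \<le> 1}\<close>, by polar coordinates.  For
  \<open>d = 1\<close> it is the counting measure on the two points of the sphere.
\<close>
definition sphere_measure :: "nat \<Rightarrow> (nat \<Rightarrow> real) measure" where
  "sphere_measure d = scale_measure (of_nat d)
     (distr (restrict_space (leb d) {x. 0 < enorm d x \<and> enorm d x \<le> 1}) (leb d)
        (\<lambda>x. vscale d (inverse (enorm d x)) x))"

text \<open>
  Lebesgue norms with values in \<^typ>\<open>ennreal\<close>, so that an upper bound also asserts finiteness.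
\<close>
definition enn_powr :: "ennreal \<Rightarrow> real \<Rightarrow> ennreal" where
  "enn_powr x r = (if x = top then top else ennreal (enn2real x powr r))"

definition Lp_norm :: "real \<Rightarrow> 'a measure \<Rightarrow> ('a \<Rightarrow> ennreal) \<Rightarrow> ennreal" where
  "Lp_norm p M g = enn_powr (\<integral>\<^sup>+ x. enn_powr (g x) p \<partial>M) (1 / p)"

definition restriction_estimate :: "nat \<Rightarrow> real \<Rightarrow> real \<Rightarrow> bool" where
  "restriction_estimate d p C \<longleftrightarrow>
     (\<forall>f. schwartz d f \<longrightarrow>
        Lp_norm 2 (sphere_measure d) (\<lambda>y. ennreal (cmod (fourier d f y)))
          \<le> ennreal C * Lp_norm p (leb d) (\<lambda>x. ennreal (cmod (f x))))"

end

theory Submission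
  imports Defs
begin

text \<open>Write \<open>m\<close> for the Fourier transform of \<open>\<mu>\<close> and \<open>T\<close> for the Fourier transform followed by restriction
  to the sphere.  By Fubini, the convolution of the transform of \<open>f\<close> with \<open>\<mu>\<^sub>t\<close> is the transform of
  \<open>z \<mapsto> f(z) m(-t z)\<close> (\<open>convolution_dilate_eq_fourier\<close>).  So the claim concerns the
  maximal function \<open>sup\<^sub>t |T (f m(-t \<cdot>))|\<close>, and the only feature of the multipliers that matters is
  their variation in \<open>t\<close>: the gradient bound gives
  \<open>|\<partial>\<^sub>t m(-t z)| \<le> D |z| (1 + t |z|)\<^sup>-\<^sup>1\<^sup>-\<^sup>\<eta>\<close>, whose integral over \<open>t > 0\<close> is \<open>D / \<eta>\<close> for every
  \<open>z \<noteq> 0\<close>, and \<open>m\<close> vanishes at infinity (\<open>ray_variation\<close>).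

  What remains is an inequality of Christ--Kiselev type.  Let \<open>t\<close> run down a finite grid and let
  \<open>w\<^sub>k\<close> be the successive increments of the multiplier.  If \<open>g i j\<close> is the \<open>p\<close>-th power
  of the \<open>L\<^sup>p\<close> norm of \<open>\<Sum>\<^sub>i\<^sub>\<le>\<^sub>k\<^sub><\<^sub>j |f w\<^sub>k|\<close>, then \<open>g\<close> is superadditive on adjacent intervals, and the
  restriction estimate bounds the squared \<open>L\<^sup>2\<close> norm of the block \<open>\<Sum>\<^sub>i\<^sub>\<le>\<^sub>k\<^sub><\<^sub>j T (f w\<^sub>k)\<close> by
  \<open>C\<^sup>2 (g i j)\<^sup>2\<^sup>/\<^sup>p\<close>.  The range of \<open>p\<close> forces \<open>p < 2\<close>, so the exponent exceeds \<open>1\<close> and bisecting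
  the interval according to \<open>g\<close> gains a factor less than \<open>1\<close>; induction on the length then bounds the
  maximal partial sum with the same right-hand side (\<open>maximal_partial_sums\<close>).  Its constant
  depends on \<open>2 / p\<close> alone, hence neither on the grid nor on \<open>d\<close>.  The total \<open>g\<close> is at most
  \<open>(D / \<eta>)\<^sup>p\<close> times the \<open>p\<close>-th power of the \<open>L\<^sup>p\<close> norm of \<open>f\<close>.

  Two approximations complete the argument.  The restriction estimate speaks about Schwartz functions,
  while \<open>f m(-t \<cdot>)\<close> is just smooth with rapidly decreasing values; compactly supported cutoffs bridge
  the gap (\<open>restriction_smooth_multiple\<close>).  And since \<open>T (f m(-t \<cdot>))\<close> is continuous in
  \<open>t\<close> at every point, Fatou's lemma passes from refining grids to all \<open>t > 0\<close>.\<close>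

section \<open>Lebesgue measure and Schwartz functions\<close>

lemma space_leb: "space (leb d) = Rd d"
  by (auto simp: leb_def Rd_def space_PiM)

lemma sigma_finite_leb: "sigma_finite_measure (leb d)"
proof -
  interpret product_sigma_finite "\<lambda>_::nat. lborel :: real measure"
    by standard
  show ?thesis unfolding leb_def by (rule sigma_finite) simp
qed

text \<open>The \<open>\<sigma>\<close>-algebra of \<^term>\<open>leb d\<close> is a product over \<open>{..<d}\<close>, whereas continuity on
  \<^term>\<open>Rd d\<close> refers to the topology of all functions \<^typ>\<open>nat \<Rightarrow> real\<close>.  Coordinates with
  index at least \<open>d\<close> are constant on \<^term>\<open>Rd d\<close>, so the inclusion is measurable coordinatewise.\<close>

lemma id_measurable_leb: "(\<lambda>x. x) \<in> leb d \<rightarrow>\<^sub>M restrict_space borel (Rd d)"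
proof (rule measurable_restrict_space2)
  show "(\<lambda>x. x) \<in> space (leb d) \<rightarrow> Rd d" by (simp add: space_leb)
  show "(\<lambda>x. x) \<in> leb d \<rightarrow>\<^sub>M borel"
  proof (rule measurable_coordinatewise_then_product)
    fix i :: nat
    show "(\<lambda>x. x i) \<in> borel_measurable (leb d)"
    proof (cases "i < d")
      case True
      then show ?thesis unfolding leb_def by (auto intro!: measurable_component_singleton[where M="\<lambda>_. lborel", simplified])
    next
      case False
      have "(\<lambda>x. x i) \<in> borel_measurable (leb d) \<longleftrightarrow> (\<lambda>_::nat\<Rightarrow>real. undefined::real) \<in> borel_measurable (leb d)"
        using False by (intro measurable_cong) (auto simp: space_leb Rd_def PiE_def extensional_def)
      then show ?thesis by simp
    qed
  qed
qed

lemma borel_measurable_leb_of_continuous: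
  fixes f :: "(nat \<Rightarrow> real) \<Rightarrow> 'b::topological_space"
  assumes "continuous_on (Rd d) f"
  shows "f \<in> borel_measurable (leb d)"
  using measurable_compose[OF id_measurable_leb borel_measurable_continuous_on_restrict[OF assms]] .

lemma measurable_leb_component [measurable]: "i < d \<Longrightarrow> (\<lambda>x. x i) \<in> borel_measurable (leb d)"
  unfolding leb_def by (auto intro!: measurable_component_singleton[where M="\<lambda>_. lborel", simplified])

lemma enorm_nonneg: "0 \<le> enorm d x"
  by (simp add: enorm_def L2_set_nonneg)

lemma abs_component_le_enorm: "i < d \<Longrightarrow> \<bar>x i\<bar> \<le> enorm d x"
  using member_le_L2_set[of "{..<d}" i "\<lambda>i. \<bar>x i\<bar>"] by (simp add: enorm_def L2_set_def)
 
lemma integrable_inverse_1_plus_square: "integrable lborel (\<lambda>x::real. inverse (1 + x\<^sup>2))"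
proof -
  have "set_integrable lborel (einterval (-\<infinity>) \<infinity>) (\<lambda>x::real. inverse (1 + x\<^sup>2))"
  proof (rule interval_integral_FTC_nonneg(1)[where F=arctan])
    show "isCont (\<lambda>x. inverse (1 + x\<^sup>2)) x" for x :: real
      by (intro continuous_intros) (simp add: add_nonneg_eq_0_iff)
    show "((arctan \<circ> real_of_ereal) \<longlongrightarrow> - (pi / 2)) (at_right (-\<infinity>))"
      by (simp add: ereal_tendsto_simps tendsto_arctan_at_bot)
    show "((arctan \<circ> real_of_ereal) \<longlongrightarrow> pi / 2) (at_left \<infinity>)"
      by (simp add: ereal_tendsto_simps tendsto_arctan_at_top)
  qed (auto intro: DERIV_arctan)
  then show ?thesis by (simp add: set_integrable_def)
qed

lemma integrable_prod_inverse_square: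
  "integrable (leb d) (\<lambda>x. \<Prod>i<d. inverse (1 + (x i)\<^sup>2))"
proof -
  interpret product_sigma_finite "\<lambda>_::nat. lborel :: real measure"
    by standard
  show ?thesis
    unfolding leb_def by (intro product_integrable_prod integrable_inverse_1_plus_square) simp
qed

text \<open>Since \<open>\<Prod>\<^sub>i (1 + x\<^sub>i\<^sup>2) \<le> (1 + |x|\<^sup>2)\<^sup>d\<close>, decay of order \<open>2 d\<close> gives a bound by
  a tensor product of functions of one variable, which are integrable.\<close>

lemma schwartz_bound:
  assumes "schwartz d f"
  obtains B where "0 \<le> B" "\<And>x. x \<in> Rd d \<Longrightarrow> cmod (f x) \<le> B"
    "\<And>x. x \<in> Rd d \<Longrightarrow> cmod (f x) \<le> B * (\<Prod>i<d. inverse (1 + (x i)\<^sup>2))"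
proof -
  have dec: "\<exists>B. \<forall>x\<in>Rd d. enorm d x ^ N * cmod (f x) \<le> B" for N
    using assms unfolding schwartz_def
    by (elim conjE allE[of _ "[]"] allE[of _ N]) (auto simp: iter_pderivative_def)
  obtain B0 where B0: "\<And>x. x \<in> Rd d \<Longrightarrow> cmod (f x) \<le> B0" using dec[of 0] by auto
  obtain B1 where B1: "\<And>x. x \<in> Rd d \<Longrightarrow> enorm d x ^ (2*d) * cmod (f x) \<le> B1" using dec[of "2*d"] by auto
  define B where "B = 2 ^ d * (\<bar>B0\<bar> + \<bar>B1\<bar>)"
  have "0 \<le> B" by (simp add: B_def)
  have one: "1 \<le> (2::real) ^ d" by simp
  have c1: "cmod (f x) \<le> B" if "x \<in> Rd d" for x
  proof -
    have "cmod (f x) \<le> \<bar>B0\<bar> + \<bar>B1\<bar>" using B0[OF that] by linarith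
    also have "\<dots> \<le> B" unfolding B_def using mult_right_mono[OF one, of "\<bar>B0\<bar> + \<bar>B1\<bar>"] by simp
    finally show ?thesis .
  qed
  have c2: "cmod (f x) \<le> B * (\<Prod>i<d. inverse (1 + (x i)\<^sup>2))" if x: "x \<in> Rd d" for x
  proof -
    let ?r = "enorm d x"
    have "(\<Prod>i<d. 1 + (x i)\<^sup>2) \<le> (\<Prod>i<d. 1 + ?r\<^sup>2)"
      by (intro prod_mono) (auto simp: abs_le_square_iff[symmetric] enorm_nonneg intro!: abs_component_le_enorm)
    also have "\<dots> = (1 + ?r\<^sup>2) ^ d" by simp
    also have "\<dots> \<le> 2 ^ d * (1 + ?r ^ (2*d))"
    proof (cases "?r \<le> 1")
      case True
      then have "(1 + ?r\<^sup>2) ^ d \<le> 2 ^ d"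
        using enorm_nonneg[of d x] by (intro power_mono) (auto simp: power_le_one)
      also have "\<dots> \<le> 2 ^ d * (1 + ?r ^ (2*d))" using enorm_nonneg[of d x] by (simp)
      finally show ?thesis .
    next
      case False
      then have "(1 + ?r\<^sup>2) ^ d \<le> (2 * ?r\<^sup>2) ^ d"
        by (intro power_mono) auto
      also have "\<dots> \<le> 2 ^ d * (1 + ?r ^ (2*d))" by (simp add: power_mult_distrib power_mult)
      finally show ?thesis .
    qed
    finally have P: "(\<Prod>i<d. 1 + (x i)\<^sup>2) \<le> 2 ^ d * (1 + ?r ^ (2*d))" .
    have pos: "0 < (\<Prod>i<d. 1 + (x i)\<^sup>2)" by (intro prod_pos) (auto simp: add_pos_nonneg)
    have "cmod (f x) * (\<Prod>i<d. 1 + (x i)\<^sup>2) \<le> cmod (f x) * (2 ^ d * (1 + ?r ^ (2*d)))"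
      using P by (intro mult_left_mono) auto
    also have "\<dots> = 2 ^ d * (cmod (f x) + ?r ^ (2*d) * cmod (f x))" by (simp add: algebra_simps)
    also have "\<dots> \<le> B" unfolding B_def using B0[OF x] B1[OF x] by (intro mult_left_mono) auto
    finally have "cmod (f x) \<le> B / (\<Prod>i<d. 1 + (x i)\<^sup>2)" using pos by (simp add: pos_le_divide_eq)
    also have "\<dots> = B * (\<Prod>i<d. inverse (1 + (x i)\<^sup>2))"
      using prod_inversef[of "\<lambda>i. 1 + (x i)\<^sup>2" "{..<d}"] by (simp add: divide_inverse comp_def)
    finally show ?thesis .
  qed
  from that[OF \<open>0 \<le> B\<close> c1 c2] show ?thesis .
qed

lemma schwartz_continuous: "schwartz d f \<Longrightarrow> continuous_on (Rd d) f"
  unfolding schwartz_def smooth_def by (elim conjE allE[of _ "[]"]) (auto simp: iter_pderivative_def)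

lemma schwartz_integrable:
  assumes "schwartz d f"
  shows "integrable (leb d) f"
proof -
  obtain B where B: "0 \<le> B"
    "\<And>x. x \<in> Rd d \<Longrightarrow> cmod (f x) \<le> B * (\<Prod>i<d. inverse (1 + (x i)\<^sup>2))"
    using schwartz_bound[OF assms] by metis
  show ?thesis
  proof (rule Bochner_Integration.integrable_bound)
    show "integrable (leb d) (\<lambda>x. B * (\<Prod>i<d. inverse (1 + (x i)\<^sup>2)))"
      using integrable_prod_inverse_square by simp
    show "f \<in> borel_measurable (leb d)"
      by (intro borel_measurable_leb_of_continuous schwartz_continuous assms)
    show "AE x in leb d. norm (f x) \<le> norm (B * (\<Prod>i<d. inverse (1 + (x i)\<^sup>2)))"
      using B(2) by (intro AE_I2) (auto simp: space_leb intro: order_trans[OF _ abs_ge_self])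
  qed
qed

lemma schwartz_powr_integrable:
  assumes "schwartz d f" "1 \<le> p"
  shows "integrable (leb d) (\<lambda>x. cmod (f x) powr p)"
proof -
  obtain B where B: "0 \<le> B" "\<And>x. x \<in> Rd d \<Longrightarrow> cmod (f x) \<le> B"
    using schwartz_bound[OF assms(1)] by metis
  note [measurable] = borel_measurable_integrable[OF schwartz_integrable[OF assms(1)]]
  show ?thesis
  proof (rule Bochner_Integration.integrable_bound)
    show "integrable (leb d) (\<lambda>x. B powr (p - 1) * cmod (f x))"
      using schwartz_integrable[OF assms(1)] by simp
    show "(\<lambda>x. cmod (f x) powr p) \<in> borel_measurable (leb d)" by measurable
    have "cmod (f x) powr p \<le> B powr (p - 1) * cmod (f x)" if "x \<in> Rd d" for x
    proof (cases "f x = 0")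
      case False
      have "cmod (f x) powr p = cmod (f x) powr (p - 1) * cmod (f x)"
        using False powr_add[of "cmod (f x)" "p-1" 1] by simp
      also have "\<dots> \<le> B powr (p - 1) * cmod (f x)"
        using B(2)[OF that] assms(2) by (intro mult_right_mono powr_mono2) auto
      finally show ?thesis .
    qed simp
    then show "AE x in leb d. norm (cmod (f x) powr p) \<le> norm (B powr (p - 1) * cmod (f x))"
      by (intro AE_I2) (auto simp: space_leb)
  qed
qed

section \<open>Smooth functions and cutoffs\<close>

lemma upd_in_Rd: "x \<in> Rd d \<Longrightarrow> i < d \<Longrightarrow> x(i := s) \<in> Rd d"
  by (auto simp: Rd_def PiE_def extensional_def)

lemma vscale_in_Rd [simp]: "vscale d c x \<in> Rd d"
  by (auto simp: Rd_def vscale_def)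

lemma continuous_on_component: "continuous_on A (\<lambda>x::nat \<Rightarrow> real. x i)"
  by (rule continuous_on_product_then_coordinatewise[OF continuous_on_id])

lemma continuous_on_vscale: "continuous_on A (vscale d c)"
proof (rule continuous_on_coordinatewise_then_product)
  show "continuous_on A (\<lambda>x. vscale d c x i)" for i
    by (cases "i < d") (auto simp: vscale_def intro!: continuous_intros continuous_on_component)
qed

text \<open>The class \<open>C\<^sup>n\<close>.  Grading smoothness by \<open>n\<close> makes products, sums and dilates accessible to
  induction on \<open>n\<close>: the derivative of a product is a sum of products of functions of class
  \<open>C\<^sup>n\<close>.\<close>

primrec smooth_upto :: "nat \<Rightarrow> nat \<Rightarrow> ((nat \<Rightarrow> real) \<Rightarrow> complex) \<Rightarrow> bool" where
  "smooth_upto d 0 f \<longleftrightarrow> continuous_on (Rd d) f"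
| "smooth_upto d (Suc n) f \<longleftrightarrow> continuous_on (Rd d) f \<and>
     (\<forall>i<d. (\<forall>x\<in>Rd d. (\<lambda>s. f (x(i := s))) differentiable (at (x i))) \<and>
            smooth_upto d n (pderivative i f))"

lemma iter_pderivative_Nil: "iter_pderivative [] f = f"
  by (simp add: iter_pderivative_def)

lemma iter_pderivative_snoc:
  "iter_pderivative (is @ [i]) f = iter_pderivative is (pderivative i f)"
  by (simp add: iter_pderivative_def)

lemma smooth_pderivative:
  assumes "smooth d f" "i < d"
  shows "smooth d (pderivative i f)"
  unfolding smooth_def
proof (intro allI impI)
  fix js assume "set js \<subseteq> {..<d}"
  then have J: "set (js @ [i]) \<subseteq> {..<d}" using \<open>i < d\<close> by auto
  show "continuous_on (Rd d) (iter_pderivative js (pderivative i f)) \<and>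
    (\<forall>x\<in>Rd d. \<forall>j<d. (\<lambda>s. iter_pderivative js (pderivative i f) (x(j := s))) differentiable at (x j))"
    using assms(1)[unfolded smooth_def, rule_format, OF J] by (simp add: iter_pderivative_snoc del: fun_upd_apply)
qed

lemma smooth_continuous: "smooth d f \<Longrightarrow> continuous_on (Rd d) f"
  unfolding smooth_def by (elim allE[of _ "[]"]) (auto simp: iter_pderivative_Nil simp del: fun_upd_apply)

lemma smooth_differentiable:
  "smooth d f \<Longrightarrow> x \<in> Rd d \<Longrightarrow> i < d \<Longrightarrow> (\<lambda>s. f (x(i := s))) differentiable (at (x i))"
  unfolding smooth_def by (elim allE[of _ "[]"]) (auto simp: iter_pderivative_Nil simp del: fun_upd_apply)

lemma smooth_iff_smooth_upto: "smooth d f \<longleftrightarrow> (\<forall>n. smooth_upto d n f)"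
proof
  assume "smooth d f"
  then have "smooth_upto d n f" for n
    by (induction n arbitrary: f)
       (auto simp: smooth_continuous smooth_differentiable smooth_pderivative simp del: fun_upd_apply)
  then show "\<forall>n. smooth_upto d n f" ..
next
  assume "\<forall>n. smooth_upto d n f"
  then have "continuous_on (Rd d) (iter_pderivative js f) \<and>
    (\<forall>x\<in>Rd d. \<forall>j<d. (\<lambda>s. iter_pderivative js f (x(j := s))) differentiable at (x j))"
    if "set js \<subseteq> {..<d}" for js
    using that
  proof (induction js arbitrary: f rule: rev_induct)
    case Nil
    from Nil.prems(1) have "smooth_upto d (Suc 0) f" by blast
    then show ?case by (simp add: iter_pderivative_Nil del: fun_upd_apply)
  next
    case (snoc j js)
    have "\<forall>n. smooth_upto d n (pderivative j f)"
    proof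
      fix n
      from snoc.prems(1) have "smooth_upto d (Suc n) f" by blast
      with snoc.prems(2) show "smooth_upto d n (pderivative j f)" by simp
    qed
    with snoc show ?case by (simp add: iter_pderivative_snoc)
  qed
  then show "smooth d f" by (auto simp: smooth_def)
qed

lemma has_pderivative:
  assumes "(\<lambda>s. f (x(i := s))) differentiable (at (x i))"
  shows "((\<lambda>s. f (x(i := s))) has_vector_derivative pderivative i f x) (at (x i))"
  using assms unfolding pderivative_def by (simp add: vector_derivative_works)

lemma pderivative_cong:
  assumes "\<And>x. x \<in> Rd d \<Longrightarrow> f x = g x" "x \<in> Rd d" "i < d"
  shows "pderivative i f x = pderivative i g x"
proof -
  have "f (x(i := s)) = g (x(i := s))" for s using assms upd_in_Rd by blast
  then show ?thesis by (simp add: pderivative_def)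
qed

lemma smooth_upto_cong:
  assumes "smooth_upto d n f" "\<And>x. x \<in> Rd d \<Longrightarrow> f x = g x"
  shows "smooth_upto d n g"
  using assms
proof (induction n arbitrary: f g)
  case 0
  then show ?case using continuous_on_cong[of "Rd d" "Rd d" f g] by simp
next
  case (Suc n)
  have c: "continuous_on (Rd d) g"
    using Suc.prems continuous_on_cong[of "Rd d" "Rd d" f g] by simp
  have "(\<lambda>s. g (x(i := s))) differentiable at (x i)" if "x \<in> Rd d" "i < d" for x i
  proof -
    have "f (x(i := s)) = g (x(i := s))" for s using Suc.prems(2) that upd_in_Rd by blast
    then have "(\<lambda>s. f (x(i := s))) = (\<lambda>s. g (x(i := s)))" by blast
    moreover have "(\<lambda>s. f (x(i := s))) differentiable at (x i)"
      using Suc.prems(1) that unfolding smooth_upto.simps by blast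
    ultimately show ?thesis by (simp del: fun_upd_apply)
  qed
  moreover have "smooth_upto d n (pderivative i g)" if "i < d" for i
    by (rule Suc.IH[of "pderivative i f"])
       (use Suc.prems that pderivative_cong[of d f g] in auto)
  ultimately show ?case using c by simp
qed

lemma smooth_upto_SucI:
  assumes "continuous_on (Rd d) f"
    and "\<And>i x. i < d \<Longrightarrow> x \<in> Rd d \<Longrightarrow>
           ((\<lambda>s. f (x(i := s))) has_vector_derivative f' i x) (at (x i))"
    and "\<And>i. i < d \<Longrightarrow> smooth_upto d n (f' i)"
  shows "smooth_upto d (Suc n) f"
proof -
  have "pderivative i f x = f' i x" if "i < d" "x \<in> Rd d" for i x
    using assms(2)[OF that] by (simp add: pderivative_def vector_derivative_at)
  then have "smooth_upto d n (pderivative i f)" if "i < d" for i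
    using smooth_upto_cong[OF assms(3)[OF that]] that by simp
  moreover have "(\<lambda>s. f (x(i := s))) differentiable at (x i)" if "i < d" "x \<in> Rd d" for i x
    using assms(2)[OF that] by (rule differentiableI_vector)
  ultimately show ?thesis using assms(1) by (simp del: fun_upd_apply)
qed

lemma smooth_upto_Suc_imp: "smooth_upto d (Suc n) f \<Longrightarrow> smooth_upto d n f"
  by (induction n arbitrary: f) auto

lemma smooth_upto_continuous: "smooth_upto d n f \<Longrightarrow> continuous_on (Rd d) f"
  by (cases n) auto

lemma smooth_upto_const: "smooth_upto d n (\<lambda>_. c)"
proof (induction n arbitrary: c)
  case (Suc n)
  then show ?case by (intro smooth_upto_SucI[where f'="\<lambda>_ _. 0"]) auto
qed simp

lemma smooth_upto_add:
  "smooth_upto d n f \<Longrightarrow> smooth_upto d n g \<Longrightarrow> smooth_upto d n (\<lambda>x. f x + g x)"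
proof (induction n arbitrary: f g)
  case (Suc n)
  have D: "((\<lambda>s. f (x(i := s)) + g (x(i := s))) has_vector_derivative
      pderivative i f x + pderivative i g x) (at (x i))" if "i < d" "x \<in> Rd d" for i x
    using has_vector_derivative_add[OF has_pderivative[of f x i] has_pderivative[of g x i]]
      Suc.prems that by simp
  have S: "smooth_upto d n (\<lambda>x. pderivative i f x + pderivative i g x)" if "i < d" for i
    using Suc.prems that by (intro Suc.IH) auto
  have "continuous_on (Rd d) f" "continuous_on (Rd d) g" using Suc.prems by auto
  then show ?case
    by (intro smooth_upto_SucI[OF _ D S] continuous_intros) auto
qed (auto intro: continuous_intros)

lemma smooth_upto_mult:
  "smooth_upto d n f \<Longrightarrow> smooth_upto d n g \<Longrightarrow> smooth_upto d n (\<lambda>x. f x * g x)"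
proof (induction n arbitrary: f g)
  case (Suc n)
  have D: "((\<lambda>s. f (x(i := s)) * g (x(i := s))) has_vector_derivative
      f x * pderivative i g x + pderivative i f x * g x) (at (x i))" if "i < d" "x \<in> Rd d" for i x
    using has_vector_derivative_mult[OF has_pderivative[of f x i] has_pderivative[of g x i]]
      Suc.prems that by simp
  have S: "smooth_upto d n (\<lambda>x. f x * pderivative i g x + pderivative i f x * g x)" if "i < d" for i
    using Suc.prems that by (intro smooth_upto_add Suc.IH smooth_upto_Suc_imp[of d n f] smooth_upto_Suc_imp[of d n g]) auto
  have "continuous_on (Rd d) f" "continuous_on (Rd d) g" using Suc.prems by auto
  then show ?case
    by (intro smooth_upto_SucI[OF _ D S] continuous_intros) auto
qed (auto intro: continuous_intros)

lemma vscale_upd: "i < d \<Longrightarrow> vscale d c (x(i := s)) = (vscale d c x)(i := c * s)"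
  by (auto simp: vscale_def)

lemma smooth_upto_vscale:
  "smooth_upto d n f \<Longrightarrow> smooth_upto d n (\<lambda>x. f (vscale d c x))"
proof (induction n arbitrary: f)
  case 0
  then show ?case
    by (auto intro!: continuous_on_compose2[OF _ continuous_on_vscale])
next
  case (Suc n)
  have D: "((\<lambda>s. f (vscale d c (x(i := s)))) has_vector_derivative
      of_real c * pderivative i f (vscale d c x)) (at (x i))" if "i < d" "x \<in> Rd d" for i x
  proof -
    have "((\<lambda>s. c * s) has_vector_derivative c) (at (x i))"
      by (auto intro!: derivative_eq_intros simp: has_real_derivative_iff_has_vector_derivative[symmetric])
    moreover have "((\<lambda>s. f ((vscale d c x)(i := s))) has_vector_derivative pderivative i f (vscale d c x)) (at (c * x i))"
    proof -
      have "vscale d c x i = c * x i" using that by (simp add: vscale_def)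
      then show ?thesis
        using has_pderivative[of f "vscale d c x" i] Suc.prems that vscale_in_Rd[of d c x]
        by (metis smooth_upto.simps(2))
    qed
    ultimately show ?thesis
      using vector_diff_chain_at[of "\<lambda>s. c * s" c "x i" "\<lambda>s. f ((vscale d c x)(i := s))"] that
      by (simp add: o_def vscale_upd scaleR_conv_of_real)
  qed
  have S: "smooth_upto d n (\<lambda>x. of_real c * pderivative i f (vscale d c x))" if "i < d" for i
    using Suc.prems that by (intro smooth_upto_mult smooth_upto_const Suc.IH) auto
  have "continuous_on (Rd d) f" using Suc.prems by simp
  then have "continuous_on (Rd d) (\<lambda>x. f (vscale d c x))"
    by (auto intro!: continuous_on_compose2[OF _ continuous_on_vscale])
  then show ?case using smooth_upto_SucI[OF _ D S] by blast
qed

text \<open>A smooth function of one variable is given by its sequence \<open>\<psi>\<close> of derivatives, so that the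
  induction can pass from \<open>\<psi> k\<close> to \<open>\<psi> (Suc k)\<close>.\<close>

lemma smooth_upto_component:
  fixes \<psi> :: "nat \<Rightarrow> real \<Rightarrow> real"
  assumes "\<And>k u. (\<psi> k has_real_derivative \<psi> (Suc k) u) (at u)" "i < d"
  shows "smooth_upto d n (\<lambda>x. of_real (\<psi> k (a + b * x i)))"
proof (induction n arbitrary: k)
  case 0
  have "continuous_on UNIV (\<psi> k)"
    by (rule DERIV_continuous_on) (rule has_field_derivative_at_within[OF assms(1)])
  then have "continuous_on (Rd d) (\<lambda>x. \<psi> k (a + b * x i))"
    by (rule continuous_on_compose2) (auto intro!: continuous_intros continuous_on_component)
  then show ?case by (simp add: continuous_on_of_real)
next
  case (Suc n)
  have C: "continuous_on (Rd d) (\<lambda>x. complex_of_real (\<psi> k (a + b * x i)))"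
    by (rule smooth_upto_continuous[OF Suc.IH])
  have D: "((\<lambda>s. complex_of_real (\<psi> k (a + b * (x(j := s)) i))) has_vector_derivative
     (if j = i then of_real b * of_real (\<psi> (Suc k) (a + b * x i)) else 0)) (at (x j))" for j x
  proof (cases "j = i")
    case True
    have "((\<lambda>s. a + b * s) has_real_derivative b) (at (x i))"
      by (auto intro!: derivative_eq_intros)
    from DERIV_chain2[OF assms(1) this]
    have "((\<lambda>s. \<psi> k (a + b * s)) has_real_derivative \<psi> (Suc k) (a + b * x i) * b) (at (x i))" .
    then have "((\<lambda>s. complex_of_real (\<psi> k (a + b * s))) has_vector_derivative
        of_real (\<psi> (Suc k) (a + b * x i) * b)) (at (x i))"
      unfolding has_real_derivative_iff_has_vector_derivative by (rule bounded_linear.has_vector_derivative[OF bounded_linear_of_real])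
    with True show ?thesis by (simp add: mult.commute)
  qed simp
  have S: "smooth_upto d n (\<lambda>x. if j = i then of_real b * of_real (\<psi> (Suc k) (a + b * x i)) else 0)" for j
  proof (cases "j = i")
    case True
    have "smooth_upto d n (\<lambda>x. of_real b * of_real (\<psi> (Suc k) (a + b * x i)))"
      by (intro smooth_upto_mult smooth_upto_const Suc.IH)
    with True show ?thesis by simp
  qed (simp add: smooth_upto_const)
  show ?case by (rule smooth_upto_SucI[OF C D S])
qed

lemma smooth_upto_prod:
  "finite I \<Longrightarrow> (\<And>i. i \<in> I \<Longrightarrow> smooth_upto d n (f i)) \<Longrightarrow> smooth_upto d n (\<lambda>x. \<Prod>i\<in>I. f i x)"
  by (induction I rule: finite_induct) (auto intro: smooth_upto_const smooth_upto_mult)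

lemma smooth_mult: "smooth d f \<Longrightarrow> smooth d g \<Longrightarrow> smooth d (\<lambda>x. f x * g x)"
  by (simp add: smooth_iff_smooth_upto smooth_upto_mult)

lemma smooth_add: "smooth d f \<Longrightarrow> smooth d g \<Longrightarrow> smooth d (\<lambda>x. f x + g x)"
  by (simp add: smooth_iff_smooth_upto smooth_upto_add)

lemma smooth_const: "smooth d (\<lambda>_. c)"
  by (simp add: smooth_iff_smooth_upto smooth_upto_const)

lemma smooth_vscale: "smooth d f \<Longrightarrow> smooth d (\<lambda>x. f (vscale d c x))"
  by (simp add: smooth_iff_smooth_upto smooth_upto_vscale)


text \<open>The \<open>k\<close>-th derivative of \<open>exp (-1/u)\<close> is \<open>q\<^sub>k(1/u) exp (-1/u)\<close> with
  \<open>q\<^sub>k\<^sub>+\<^sub>1(y) = y\<^sup>2 (q\<^sub>k(y) - q\<^sub>k'(y))\<close>; extended by \<open>0\<close> to \<open>u \<le> 0\<close> these functions form a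
  sequence of successive derivatives on the whole line.\<close>

primrec flat_poly :: "nat \<Rightarrow> real poly" where
  "flat_poly 0 = 1"
| "flat_poly (Suc k) = [:0, 0, 1:] * (flat_poly k - pderiv (flat_poly k))"

definition flat_exp :: "nat \<Rightarrow> real \<Rightarrow> real" where
  "flat_exp k u = (if u \<le> 0 then 0 else poly (flat_poly k) (1 / u) * exp (- (1 / u)))"

lemma tendsto_poly_times_exp_minus: "((\<lambda>y::real. poly P y * exp (- y)) \<longlongrightarrow> 0) at_top"
proof -
  have "((\<lambda>y. \<Sum>i\<le>degree P. coeff P i * (y ^ i / exp y)) \<longlongrightarrow> (\<Sum>i\<le>degree P. coeff P i * 0)) at_top"
    by (intro tendsto_intros tendsto_power_div_exp_0)
  then show ?thesis by (simp add: poly_altdef sum_distrib_right exp_minus divide_inverse mult.assoc)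
qed

lemma flat_exp_deriv: "(flat_exp k has_real_derivative flat_exp (Suc k) u) (at u)"
proof -
  consider "u < 0" | "u = 0" | "0 < u" by linarith
  then show ?thesis
  proof cases
    case 1
    have "((\<lambda>_. 0) has_real_derivative 0) (at u)" by simp
    then have "(flat_exp k has_real_derivative 0) (at u)"
      by (rule has_field_derivative_transform_within_open[of _ _ _ "{..<0}"]) (use 1 in \<open>auto simp: flat_exp_def\<close>)
    with 1 show ?thesis by (simp add: flat_exp_def)
  next
    case 3
    have "((\<lambda>u. poly (flat_poly k) (1 / u) * exp (- (1 / u))) has_real_derivative flat_exp (Suc k) u) (at u)"
    proof -
      let ?P = "flat_poly k"
      have i: "((\<lambda>u. 1 / u) has_real_derivative - (1 / u)\<^sup>2) (at u)"
        using 3 by (auto intro!: derivative_eq_intros simp: field_simps power2_eq_square)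
      have "((\<lambda>u. poly ?P (1 / u)) has_real_derivative poly (pderiv ?P) (1 / u) * - (1 / u)\<^sup>2) (at u)"
        by (rule DERIV_chain2[OF poly_DERIV i])
      moreover have "((\<lambda>u. exp (- (1 / u))) has_real_derivative exp (- (1 / u)) * - (- (1 / u)\<^sup>2)) (at u)"
        by (rule DERIV_chain2[OF DERIV_exp DERIV_minus[OF i]])
      ultimately have "((\<lambda>u. poly ?P (1 / u) * exp (- (1 / u))) has_real_derivative
          poly (pderiv ?P) (1 / u) * - (1 / u)\<^sup>2 * exp (- (1 / u))
          + exp (- (1 / u)) * - (- (1 / u)\<^sup>2) * poly ?P (1 / u)) (at u)"
        by (rule DERIV_mult)
      moreover have "poly (pderiv ?P) (1 / u) * - (1 / u)\<^sup>2 * exp (- (1 / u))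
          + exp (- (1 / u)) * - (- (1 / u)\<^sup>2) * poly ?P (1 / u) = flat_exp (Suc k) u"
        using 3 by (simp add: flat_exp_def power2_eq_square algebra_simps)
      ultimately show ?thesis by simp
    qed
    then show ?thesis
      by (rule has_field_derivative_transform_within_open[of _ _ _ "{0<..}"]) (use 3 in \<open>auto simp: flat_exp_def\<close>)
  next
    case 2
    have "((\<lambda>h. flat_exp k h / h) \<longlongrightarrow> 0) (at_right 0)"
    proof -
      have "((\<lambda>h::real. poly ([:0,1:] * flat_poly k) (inverse h) * exp (- inverse h)) \<longlongrightarrow> 0) (at_right 0)"
        by (rule filterlim_compose[OF tendsto_poly_times_exp_minus filterlim_inverse_at_top_right])
      then show ?thesis
        by (rule Lim_transform_eventually)
           (auto simp: eventually_at_filter flat_exp_def field_simps)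
    qed
    moreover have "((\<lambda>h. flat_exp k h / h) \<longlongrightarrow> 0) (at_left 0)"
      by (rule Lim_transform_eventually[OF tendsto_const])
         (auto simp: eventually_at_filter flat_exp_def)
    ultimately have "((\<lambda>h. flat_exp k h / h) \<longlongrightarrow> 0) (at 0)"
      by (simp add: filterlim_split_at)
    then show ?thesis using 2 by (simp add: DERIV_def flat_exp_def)
  qed
qed

text \<open>The factor \<open>exp 2\<close> normalises the value at the origin to \<open>1\<close>, whence the pointwise limit \<open>1\<close> as
  \<open>R \<rightarrow> \<infinity>\<close>.  A tensor product suits a notion of smoothness that is expressed by coordinates.\<close>

definition cutoff :: "nat \<Rightarrow> real \<Rightarrow> (nat \<Rightarrow> real) \<Rightarrow> real" where
  "cutoff d R x = (\<Prod>i<d. exp 2 * flat_exp 0 (1 - x i / R) * flat_exp 0 (1 + x i / R))"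

lemma flat_exp_0_nonneg: "0 \<le> flat_exp 0 u"
  by (simp add: flat_exp_def)

lemma bump_le_one: "exp 2 * flat_exp 0 (1 - v) * flat_exp 0 (1 + v) \<le> 1"
proof (cases "\<bar>v\<bar> < 1")
  case True
  then have v: "0 < 1 - v" "0 < 1 + v" by auto
  have "1 / (1 - v) + 1 / (1 + v) = 2 / (1 - v\<^sup>2)"
    using v by (simp add: field_simps power2_eq_square)
  moreover have "0 < 1 - v\<^sup>2" using True by (simp add: abs_square_less_1)
  then have "2 \<le> 2 / (1 - v\<^sup>2)" by (simp add: field_simps)
  ultimately have "2 - 1 / (1 - v) - 1 / (1 + v) \<le> 0" by linarith
  then have "exp (2 - 1 / (1 - v) - 1 / (1 + v)) \<le> 1" by simp
  moreover have "exp (2 - 1 / (1 - v) - 1 / (1 + v)) = exp 2 * exp (- (1 / (1 - v))) * exp (- (1 / (1 + v)))"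
    by (simp add: exp_add[symmetric])
  ultimately show ?thesis using v by (simp add: flat_exp_def)
next
  case False
  then have "1 - v \<le> 0 \<or> 1 + v \<le> 0" by linarith
  then show ?thesis by (auto simp: flat_exp_def)
qed

lemma cutoff_nonneg: "0 \<le> cutoff d R x"
  unfolding cutoff_def by (intro prod_nonneg) (auto simp: flat_exp_0_nonneg)

lemma cutoff_le_one: "cutoff d R x \<le> 1"
  unfolding cutoff_def by (intro prod_le_1) (auto simp: flat_exp_0_nonneg bump_le_one)

lemma cutoff_eq_0: "0 < R \<Longrightarrow> i < d \<Longrightarrow> R < \<bar>x i\<bar> \<Longrightarrow> cutoff d R x = 0"
  unfolding cutoff_def by (intro prod_zero) (auto intro!: bexI[of _ i] simp: flat_exp_def abs_if field_simps split: if_splits)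

lemma cutoff_tendsto: "(\<lambda>n. cutoff d (real (Suc n)) x) \<longlonglongrightarrow> 1"
proof -
  have c: "isCont (flat_exp 0) 1"
    using flat_exp_deriv DERIV_isCont by blast
  have z: "(\<lambda>n. x i / real (Suc n)) \<longlonglongrightarrow> 0" for i
    using LIMSEQ_Suc[OF lim_const_over_n[of "x i"]] by simp
  have "(\<lambda>n. cutoff d (real (Suc n)) x) \<longlonglongrightarrow> (\<Prod>i<d. exp 2 * flat_exp 0 1 * flat_exp 0 1)"
    unfolding cutoff_def
    by (intro tendsto_prod tendsto_mult tendsto_const isCont_tendsto_compose[OF c])
       (use tendsto_diff[OF tendsto_const z, of 1] tendsto_add[OF tendsto_const z, of 1] in auto)
  moreover have "exp 2 * flat_exp 0 1 * flat_exp 0 1 = 1"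
    by (simp add: flat_exp_def exp_add[symmetric] mult.assoc)
  ultimately show ?thesis by simp
qed

lemma smooth_cutoff:
  assumes "0 < R" shows "smooth d (\<lambda>x. of_real (cutoff d R x))"
  unfolding smooth_iff_smooth_upto
proof
  fix n
  have S: "smooth_upto d n (\<lambda>x. of_real (flat_exp 0 (1 + b * x i)))" if "i < d" for i b
    using smooth_upto_component[where \<psi>=flat_exp and k=0, OF flat_exp_deriv that] .
  have "smooth_upto d n (\<lambda>x. \<Prod>i<d. of_real (exp 2) * of_real (flat_exp 0 (1 + (- 1 / R) * x i)) * of_real (flat_exp 0 (1 + (1 / R) * x i)))"
    by (intro smooth_upto_prod smooth_upto_mult smooth_upto_const S) auto
  then show "smooth_upto d n (\<lambda>x. of_real (cutoff d R x))"
    by (simp add: cutoff_def)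
qed

text \<open>Vanishing off a closed box passes to derivatives because the complement of the box is open.\<close>

lemma pderivative_zero_outside_box:
  assumes "\<And>x. x \<in> Rd d \<Longrightarrow> (\<exists>i<d. R < \<bar>x i\<bar>) \<Longrightarrow> h x = 0" "x \<in> Rd d" "j < d" "i < d" "R < \<bar>x i\<bar>"
  shows "pderivative j h x = 0"
proof -
  have "((\<lambda>s. h (x(j := s))) has_vector_derivative 0) (at (x j))"
  proof (rule has_vector_derivative_transform_within_open[of "\<lambda>_. 0"])
    show "((\<lambda>_. 0) has_vector_derivative 0) (at (x j))" by simp
    have "open {s::real. R < \<bar>s\<bar>}"
      by (intro open_Collect_less continuous_intros)
    then show "open (if j = i then {s. R < \<bar>s\<bar>} else UNIV)" by simp
    show "x j \<in> (if j = i then {s. R < \<bar>s\<bar>} else UNIV)" using assms(5) by simp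
    fix s assume "s \<in> (if j = i then {s. R < \<bar>s\<bar>} else UNIV)"
    then have "R < \<bar>(x(j := s)) i\<bar>" using assms(5) by (simp split: if_splits)
    then have "\<exists>i<d. R < \<bar>(x(j := s)) i\<bar>" using assms(4) by blast
    then show "0 = h (x(j := s))" using assms(1)[OF upd_in_Rd[OF assms(2,3)]] by simp
  qed
  then show ?thesis by (simp add: pderivative_def vector_derivative_at)
qed

lemma compact_box: "compact {x \<in> Rd d. \<forall>i<d. \<bar>x i\<bar> \<le> R}"
proof -
  have "{x \<in> Rd d. \<forall>i<d. \<bar>x i\<bar> \<le> R} = (\<Pi>\<^sub>E i\<in>UNIV. if i < d then {-R..R} else {undefined})"
    by (auto simp: Rd_def PiE_def extensional_def Pi_def abs_le_iff split: if_splits)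
  moreover have "compactin (product_topology (\<lambda>_. euclidean) UNIV) (\<Pi>\<^sub>E i\<in>(UNIV::nat set). if i < d then {-R..R} else {undefined::real})"
    unfolding compactin_PiE by auto
  ultimately show ?thesis by (simp add: euclidean_product_topology)
qed

lemma schwartz_if_zero_outside_box:
  assumes "smooth d h" "\<And>x. x \<in> Rd d \<Longrightarrow> (\<exists>i<d. R < \<bar>x i\<bar>) \<Longrightarrow> h x = 0"
  shows "schwartz d h"
  unfolding schwartz_def
proof (intro conjI allI impI)
  show "smooth d h" by fact
  fix js N assume js: "set js \<subseteq> {..<d}"
  have Z: "iter_pderivative js h x = 0" if "x \<in> Rd d" "\<exists>i<d. R < \<bar>x i\<bar>" for x
    using js that
  proof (induction js arbitrary: x)
    case Nil
    then show ?case using assms(2) by (simp add: iter_pderivative_def)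
  next
    case (Cons j js)
    then show ?case
      using pderivative_zero_outside_box[of d R "iter_pderivative js h" x j]
      by (auto simp: iter_pderivative_def)
  qed
  let ?K = "{x \<in> Rd d. \<forall>i<d. \<bar>x i\<bar> \<le> R}"
  have "continuous_on (Rd d) (iter_pderivative js h)"
    using assms(1) js by (auto simp: smooth_def)
  then have "continuous_on ?K (\<lambda>x. enorm d x ^ N * cmod (iter_pderivative js h x))"
    unfolding enorm_def L2_set_def
    by (intro continuous_intros continuous_on_component) (auto elim: continuous_on_subset)
  then have "compact ((\<lambda>x. enorm d x ^ N * cmod (iter_pderivative js h x)) ` ?K)"
    by (intro compact_continuous_image compact_box)
  from compact_imp_bounded[OF this]
  obtain B where "\<forall>y\<in>(\<lambda>x. enorm d x ^ N * cmod (iter_pderivative js h x)) ` ?K. norm y \<le> B"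
    unfolding bounded_iff by blast
  then have B: "\<bar>enorm d x ^ N * cmod (iter_pderivative js h x)\<bar> \<le> B" if "x \<in> ?K" for x
    using that by (metis (no_types, lifting) image_eqI real_norm_def)
  have "enorm d x ^ N * cmod (iter_pderivative js h x) \<le> max B 0" if "x \<in> Rd d" for x
  proof (cases "x \<in> ?K")
    case True
    then show ?thesis using B[OF True] by linarith
  next
    case False
    then have "iter_pderivative js h x = 0" using that by (intro Z) (auto simp: not_le)
    then show ?thesis by simp
  qed
  then show "\<exists>B. \<forall>x\<in>Rd d. enorm d x ^ N * cmod (iter_pderivative js h x) \<le> B" by blast
qed

section \<open>A maximal inequality for partial sums\<close>

text \<open>The weight \<open>l\<close> keeps the constant in front of one summand as close to \<open>1\<close> as desired, which
  the induction in the maximal inequality depends on.\<close>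

lemma norm_add_squared_le:
  fixes u v :: "'a::real_normed_vector"
  assumes "0 < l"
  shows "(norm (u + v))\<^sup>2 \<le> (1 + 1 / l) * (norm u)\<^sup>2 + (1 + l) * (norm v)\<^sup>2"
proof -
  have "(norm (u + v))\<^sup>2 \<le> (norm u + norm v)\<^sup>2"
    by (intro power_mono norm_triangle_ineq) auto
  also have "\<dots> = (norm u)\<^sup>2 + (norm v)\<^sup>2 + 2 * norm u * norm v"
    by (simp add: power2_eq_square algebra_simps)
  also have "2 * norm u * norm v \<le> (1 / l) * (norm u)\<^sup>2 + l * (norm v)\<^sup>2"
  proof -
    have "0 \<le> (norm u - l * norm v)\<^sup>2 / l" using assms by simp
    also have "\<dots> = (1 / l) * (norm u)\<^sup>2 + l * (norm v)\<^sup>2 - 2 * norm u * norm v"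
      using assms by (simp add: field_simps power2_eq_square)
    finally show ?thesis by simp
  qed
  finally show ?thesis by (simp add: algebra_simps)
qed

text \<open>The first index \<open>m\<close> at which \<open>g a m\<close> reaches half of \<open>g a b\<close> leaves at most half of the
  total on \<open>[m, b)\<close>, by superadditivity, and at most half on \<open>[a, m - 1)\<close>, by minimality.\<close>

lemma exists_half_split:
  fixes g :: "nat \<Rightarrow> nat \<Rightarrow> real"
  assumes "a < b"
    and nonneg: "\<And>i j. 0 \<le> g i j"
    and super: "\<And>i j k. i \<le> j \<Longrightarrow> j \<le> k \<Longrightarrow> g i j + g j k \<le> g i k"
  obtains m where "a < m" "m \<le> b" "g a (m - 1) \<le> g a b / 2" "g m b \<le> g a b / 2"
proof -
  let ?P = "\<lambda>m. a < m \<and> g a b / 2 \<le> g a m"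
  define m where "m = (LEAST m. ?P m)"
  have b: "?P b" using assms(1) nonneg[of a b] by simp
  then have m: "?P m" and "m \<le> b" unfolding m_def by (rule LeastI, rule Least_le)
  have "g m b \<le> g a b / 2"
    using super[of a m b] m \<open>m \<le> b\<close> by simp
  moreover have "g a (m - 1) \<le> g a b / 2"
  proof (cases "a < m - 1")
    case True
    then have "\<not> ?P (m - 1)" using not_less_Least[of "m - 1" ?P] m_def by auto
    with True show ?thesis by simp
  next
    case False
    then have "m - 1 = a" using m by linarith
    moreover have "g a a \<le> 0" using super[of a a a] by simp
    ultimately show ?thesis using nonneg[of a b] by simp
  qed
  ultimately show ?thesis using that m \<open>m \<le> b\<close> by blast
qed

text \<open>The fixed point \<open>K\<close> of \<open>K = (1 + 1/l) + (1 + l) \<theta> K\<close>, where \<open>\<theta> = 2\<^sup>1\<^sup>-\<^sup>\<alpha> < 1\<close> and \<open>l\<close> is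
  chosen so that \<open>(1 + l) \<theta>\<close> is the midpoint of \<open>\<theta>\<close> and \<open>1\<close>.\<close>

definition maximal_const :: "real \<Rightarrow> real" where
  "maximal_const \<alpha> = (let \<theta> = 2 powr (1 - \<alpha>); l = (1 - \<theta>) / (2 * \<theta>) in (1 + 1 / l) / (1 - (1 + l) * \<theta>))"

lemma maximal_const:
  assumes "1 < \<alpha>"
  obtains l where "0 < l" "0 \<le> maximal_const \<alpha>"
    "(1 + 1 / l) + (1 + l) * (maximal_const \<alpha> * 2 powr (1 - \<alpha>)) = maximal_const \<alpha>"
proof -
  define \<theta> :: real where "\<theta> = 2 powr (1 - \<alpha>)"
  define l where "l = (1 - \<theta>) / (2 * \<theta>)"
  have t: "0 < \<theta>" by (simp add: \<theta>_def)
  have "2 powr (1 - \<alpha>) < 2 powr (0::real)" using assms by (intro powr_less_mono) auto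
  then have t1: "\<theta> < 1" by (simp add: \<theta>_def)
  then have l: "0 < l" using t by (simp add: l_def)
  have e: "(1 + l) * \<theta> = (1 + \<theta>) / 2" using t by (simp add: l_def field_simps)
  have K: "maximal_const \<alpha> = (1 + 1 / l) / (1 - (1 + l) * \<theta>)"
    by (simp add: maximal_const_def Let_def \<theta>_def l_def)
  have pos: "0 < 1 - (1 + l) * \<theta>" using t1 by (simp add: e)
  have "maximal_const \<alpha> * (1 - (1 + l) * \<theta>) = 1 + 1 / l" using pos by (simp add: K)
  then have "(1 + 1 / l) + (1 + l) * (maximal_const \<alpha> * \<theta>) = maximal_const \<alpha>" by (simp add: algebra_simps)
  moreover have "0 \<le> maximal_const \<alpha>" unfolding K using pos l by (intro divide_nonneg_pos) auto
  ultimately show ?thesis using that l unfolding \<theta>_def by blast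
qed

text \<open>Square integral bounds for blocks of a series, with a superadditive \<open>g\<close> raised to a power
  \<open>\<alpha> > 1\<close>, self-improve to the maximal partial sum.  Split \<open>[a, b)\<close> at an index \<open>m\<close> for which
  \<open>[a, m - 1)\<close> and \<open>[m, b)\<close> carry at most half of \<open>g a b\<close>.  A partial sum that stops before \<open>m\<close> is controlled by the
  left maximal function, and one that stops later by the block \<open>[a, m)\<close> plus the right maximal
  function.  By induction the two maximal functions together cost \<open>(1 + l) \<cdot> 2 \<cdot> 2\<^sup>-\<^sup>\<alpha>\<close> times
  the constant.  As \<open>2 \<cdot> 2\<^sup>-\<^sup>\<alpha> < 1\<close>, this factor stays below \<open>1\<close> for small \<open>l\<close>, which leaves room for
  the block term.\<close>

theorem maximal_partial_sums:
  fixes \<Phi> :: "nat \<Rightarrow> 'a \<Rightarrow> complex" and g :: "nat \<Rightarrow> nat \<Rightarrow> real"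
  assumes meas: "\<And>j. \<Phi> j \<in> borel_measurable M"
    and alpha: "1 < \<alpha>" and A: "0 \<le> A"
    and nonneg: "\<And>i j. 0 \<le> g i j"
    and super: "\<And>i j k. i \<le> j \<Longrightarrow> j \<le> k \<Longrightarrow> g i j + g j k \<le> g i k"
    and bound: "\<And>i j. (\<integral>\<^sup>+x. ennreal ((cmod (\<Sum>k\<in>{i..<j}. \<Phi> k x))\<^sup>2) \<partial>M) \<le> ennreal (A * g i j powr \<alpha>)"
    and "a \<le> b"
  shows "(\<integral>\<^sup>+x. (SUP k\<in>{a..b}. ennreal ((cmod (\<Sum>j\<in>{a..<k}. \<Phi> j x))\<^sup>2)) \<partial>M)
           \<le> ennreal (maximal_const \<alpha> * A * g a b powr \<alpha>)"
  using \<open>a \<le> b\<close>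
proof (induction "b - a" arbitrary: a b rule: less_induct)
  case less
  obtain l where l: "0 < l" and K0: "0 \<le> maximal_const \<alpha>"
    and K: "(1 + 1 / l) + (1 + l) * (maximal_const \<alpha> * 2 powr (1 - \<alpha>)) = maximal_const \<alpha>"
    using maximal_const[OF alpha] .
  note [measurable] = meas
  show ?case
  proof (cases "a = b")
    case True
    then show ?thesis by simp
  next
    case False
    then have "a < b" using less.prems by simp
    then obtain m where m: "a < m" "m \<le> b" and g1: "g a (m - 1) \<le> g a b / 2" and g2: "g m b \<le> g a b / 2"
      using exists_half_split[of a b g] nonneg super by metis
    define S where "S i k x = ennreal ((cmod (\<Sum>j\<in>{i..<k}. \<Phi> j x))\<^sup>2)" for i k x
    define M1 where "M1 x = (SUP k\<in>{a..m - 1}. S a k x)" for x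
    define M2 where "M2 x = (SUP k\<in>{m..b}. S m k x)" for x
    have [measurable]: "S i k \<in> borel_measurable M" for i k unfolding S_def by measurable
    have [measurable]: "M1 \<in> borel_measurable M" "M2 \<in> borel_measurable M"
      unfolding M1_def M2_def by (auto intro!: borel_measurable_SUP)
    have point: "(SUP k\<in>{a..b}. S a k x)
        \<le> ennreal (1 + 1 / l) * S a m x + ennreal (1 + l) * (M1 x + M2 x)" for x
    proof (rule SUP_least)
      fix k assume k: "k \<in> {a..b}"
      show "S a k x \<le> ennreal (1 + 1 / l) * S a m x + ennreal (1 + l) * (M1 x + M2 x)"
      proof (cases "k < m")
        case True
        then have "S a k x \<le> M1 x" unfolding M1_def using k by (intro SUP_upper) auto
        also have "\<dots> \<le> ennreal (1 + l) * M1 x"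
          using l mult_right_mono[of 1 "ennreal (1 + l)" "M1 x"] by simp
        also have "\<dots> \<le> ennreal (1 + l) * (M1 x + M2 x)" by (intro mult_left_mono) auto
        finally show ?thesis by (simp add: add_increasing)
      next
        case False
        have "(\<Sum>j\<in>{a..<k}. \<Phi> j x) = (\<Sum>j\<in>{a..<m}. \<Phi> j x) + (\<Sum>j\<in>{m..<k}. \<Phi> j x)"
          using False m by (simp add: sum.atLeastLessThan_concat)
        then have "S a k x \<le> ennreal ((1 + 1 / l) * (cmod (\<Sum>j\<in>{a..<m}. \<Phi> j x))\<^sup>2
            + (1 + l) * (cmod (\<Sum>j\<in>{m..<k}. \<Phi> j x))\<^sup>2)"
          unfolding S_def using norm_add_squared_le[OF l] by (auto intro!: ennreal_leI)
        also have "\<dots> = ennreal (1 + 1 / l) * S a m x + ennreal (1 + l) * S m k x"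
          using l unfolding S_def by (simp add: ennreal_plus ennreal_mult)
        also have "S m k x \<le> M1 x + M2 x"
          unfolding M2_def using False k by (intro add_increasing SUP_upper) auto
        finally show ?thesis by (simp add: add_left_mono mult_left_mono)
      qed
    qed
    have half: "2 * (t / 2) powr \<alpha> = 2 powr (1 - \<alpha>) * t powr \<alpha>" if "0 \<le> t" for t :: real
      using that by (simp add: powr_divide powr_diff)
    have I1: "(\<integral>\<^sup>+x. M1 x \<partial>M) \<le> ennreal (maximal_const \<alpha> * A * (g a b / 2) powr \<alpha>)"
    proof -
      have "(\<integral>\<^sup>+x. M1 x \<partial>M) \<le> ennreal (maximal_const \<alpha> * A * g a (m - 1) powr \<alpha>)"
        unfolding M1_def S_def using m by (intro less.hyps) auto
      also have "\<dots> \<le> ennreal (maximal_const \<alpha> * A * (g a b / 2) powr \<alpha>)"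
        using g1 K0 A nonneg alpha by (intro ennreal_leI mult_left_mono powr_mono2) auto
      finally show ?thesis .
    qed
    have I2: "(\<integral>\<^sup>+x. M2 x \<partial>M) \<le> ennreal (maximal_const \<alpha> * A * (g a b / 2) powr \<alpha>)"
    proof -
      have "(\<integral>\<^sup>+x. M2 x \<partial>M) \<le> ennreal (maximal_const \<alpha> * A * g m b powr \<alpha>)"
        unfolding M2_def S_def using m by (intro less.hyps) auto
      also have "\<dots> \<le> ennreal (maximal_const \<alpha> * A * (g a b / 2) powr \<alpha>)"
        using g2 K0 A nonneg alpha by (intro ennreal_leI mult_left_mono powr_mono2) auto
      finally show ?thesis .
    qed
    have I0: "(\<integral>\<^sup>+x. S a m x \<partial>M) \<le> ennreal (A * g a b powr \<alpha>)"
    proof -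
      have "(\<integral>\<^sup>+x. S a m x \<partial>M) \<le> ennreal (A * g a m powr \<alpha>)" unfolding S_def by (rule bound)
      also have "g a m \<le> g a b" using super[of a m b] m nonneg[of m b] by simp
      then have "ennreal (A * g a m powr \<alpha>) \<le> ennreal (A * g a b powr \<alpha>)"
        using A nonneg alpha by (intro ennreal_leI mult_left_mono powr_mono2) auto
      finally show ?thesis .
    qed
    have "(\<integral>\<^sup>+x. (SUP k\<in>{a..b}. S a k x) \<partial>M)
        \<le> (\<integral>\<^sup>+x. ennreal (1 + 1 / l) * S a m x + ennreal (1 + l) * (M1 x + M2 x) \<partial>M)"
      by (intro nn_integral_mono point)
    also have "\<dots> = ennreal (1 + 1 / l) * (\<integral>\<^sup>+x. S a m x \<partial>M)
        + ennreal (1 + l) * ((\<integral>\<^sup>+x. M1 x \<partial>M) + (\<integral>\<^sup>+x. M2 x \<partial>M))"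
      by (simp add: nn_integral_add nn_integral_cmult)
    also have "\<dots> \<le> ennreal (1 + 1 / l) * ennreal (A * g a b powr \<alpha>)
        + ennreal (1 + l) * (ennreal (maximal_const \<alpha> * A * (g a b / 2) powr \<alpha>)
          + ennreal (maximal_const \<alpha> * A * (g a b / 2) powr \<alpha>))"
      by (intro add_mono mult_left_mono I0 I1 I2) auto
    also have "\<dots> = ennreal ((1 + 1 / l) * (A * g a b powr \<alpha>)
        + (1 + l) * (maximal_const \<alpha> * A * (g a b / 2) powr \<alpha> + maximal_const \<alpha> * A * (g a b / 2) powr \<alpha>))"
    proof -
      have e: "ennreal p * ennreal X + ennreal q * (ennreal Y + ennreal Y) = ennreal (p * X + q * (Y + Y))"
        if "0 \<le> p" "0 \<le> q" "0 \<le> X" "0 \<le> Y" for p q X Y :: real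
        using that by (simp add: ennreal_plus[symmetric] ennreal_mult[symmetric] del: ennreal_plus)
      show ?thesis by (rule e) (use l A K0 in auto)
    qed
    also have "(1 + 1 / l) * (A * g a b powr \<alpha>)
        + (1 + l) * (maximal_const \<alpha> * A * (g a b / 2) powr \<alpha> + maximal_const \<alpha> * A * (g a b / 2) powr \<alpha>)
        = ((1 + 1 / l) + (1 + l) * (maximal_const \<alpha> * 2 powr (1 - \<alpha>))) * A * g a b powr \<alpha>"
      using half[OF nonneg[of a b]] by (simp add: algebra_simps)
    finally show ?thesis unfolding K S_def .
  qed
qed

section \<open>Variation along rays\<close>

text \<open>Only the first \<open>k\<close> coordinates of \<open>s z\<close> move along the ray.  These curves interpolate between
  the constant one and the full ray, so the chain rule reduces to adding one coordinate at a time.\<close>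

definition partial_ray :: "nat \<Rightarrow> (nat \<Rightarrow> real) \<Rightarrow> real \<Rightarrow> nat \<Rightarrow> real \<Rightarrow> nat \<Rightarrow> real" where
  "partial_ray d z s k u = (\<lambda>i\<in>{..<d}. if i < k then u * z i else s * z i)"

lemma partial_ray_in_Rd: "partial_ray d z s k u \<in> Rd d"
  by (auto simp: partial_ray_def Rd_def)

text \<open>Adding the coordinate \<open>k\<close> amounts to differentiating a function of two variables along the
  diagonal: it is differentiable in the first variable by induction, and continuously
  differentiable in the second.\<close>

lemma has_vector_derivative_partial_ray:
  assumes "smooth d f" "k \<le> d"
  shows "((\<lambda>u. f (partial_ray d z s k u)) has_vector_derivative
      (\<Sum>i<k. of_real (z i) * pderivative i f (vscale d s z))) (at s)"
  using \<open>k \<le> d\<close>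
proof (induction k)
  case 0
  then show ?case by (simp add: partial_ray_def)
next
  case (Suc k)
  then have k: "k < d" by simp
  define F where "F u v = f ((partial_ray d z s k u)(k := v * z k))" for u v
  define G where "G u v = of_real (z k) * pderivative k f ((partial_ray d z s k u)(k := v * z k))" for u v
  let ?D = "\<Sum>i<k. of_real (z i) * pderivative i f (vscale d s z)"
  have id: "(partial_ray d z s k u)(k := s * z k) = partial_ray d z s k u" for u
    using k by (auto simp: partial_ray_def)
  have ray0: "partial_ray d z s k s = vscale d s z"
    by (auto simp: partial_ray_def vscale_def)
  have Suc_ray: "(partial_ray d z s k u)(k := u * z k) = partial_ray d z s (Suc k) u" for u
    using k by (auto simp: partial_ray_def less_Suc_eq)
  have R: "(partial_ray d z s k u)(k := v) \<in> Rd d" for u v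
    by (intro upd_in_Rd partial_ray_in_Rd k)
  have fx: "((\<lambda>u. F u s) has_derivative (\<lambda>h. h *\<^sub>R ?D)) (at s within UNIV)"
    using Suc k unfolding F_def id by (simp add: has_vector_derivative_def)
  have fy: "((\<lambda>v. F u v) has_derivative blinfun_apply (blinfun_scaleR_left (G u v))) (at v within UNIV)" for u v
  proof -
    let ?x = "(partial_ray d z s k u)(k := v * z k)"
    have "((\<lambda>t. f (?x(k := t))) has_vector_derivative pderivative k f ?x) (at (?x k))"
      by (intro has_pderivative smooth_differentiable[OF assms(1) R k])
    then have "((\<lambda>t. f ((partial_ray d z s k u)(k := t))) has_vector_derivative pderivative k f ?x) (at (v * z k))"
      by simp
    moreover have "((\<lambda>v. v * z k) has_vector_derivative z k) (at v)"
      by (auto intro!: derivative_eq_intros simp: has_real_derivative_iff_has_vector_derivative[symmetric])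
    ultimately have "((\<lambda>v. F u v) has_vector_derivative G u v) (at v)"
      using vector_diff_chain_at[of "\<lambda>v. v * z k" "z k" v "\<lambda>t. f ((partial_ray d z s k u)(k := t))"]
      by (simp add: o_def F_def G_def scaleR_conv_of_real)
    then show ?thesis by (simp add: has_vector_derivative_def)
  qed
  have cont: "continuous (at (s, s) within UNIV \<times> UNIV) (\<lambda>(u, v). blinfun_scaleR_left (G u v))"
  proof -
    have "continuous_on UNIV (\<lambda>p. (partial_ray d z s k (fst p))(k := snd p * z k))"
    proof (rule continuous_on_coordinatewise_then_product)
      fix i
      show "continuous_on UNIV (\<lambda>p. ((partial_ray d z s k (fst p))(k := snd p * z k)) i)"
        by (cases "i = k"; cases "i < k"; cases "i < d")
           (auto simp: partial_ray_def intro!: continuous_intros)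
    qed
    then have "continuous_on UNIV (\<lambda>p. pderivative k f ((partial_ray d z s k (fst p))(k := snd p * z k)))"
      by (rule continuous_on_compose2[OF smooth_continuous[OF smooth_pderivative[OF assms(1) k]]])
         (use R in auto)
    then have "continuous_on UNIV (\<lambda>p. blinfun_scaleR_left (G (fst p) (snd p)))"
      unfolding G_def
      by (intro bounded_linear.continuous_on[OF bounded_linear_blinfun_scaleR_left] continuous_intros)
    then show ?thesis
      by (simp add: continuous_on_eq_continuous_within case_prod_beta')
  qed
  have "((\<lambda>(u, v). F u v) has_derivative (\<lambda>(tu, tv). tu *\<^sub>R ?D + blinfun_apply (blinfun_scaleR_left (G s s)) tv))
      (at (s, s) within UNIV \<times> UNIV)"
    by (rule has_derivative_partialsI[OF fx fy cont]) auto
  then have F': "((\<lambda>(u, v). F u v) has_derivative (\<lambda>(tu, tv). tu *\<^sub>R ?D + tv *\<^sub>R G s s)) (at (s, s))"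
    by simp
  have "((\<lambda>u. (u, u)) has_derivative (\<lambda>h. (h, h))) (at s)"
    by (auto intro!: derivative_eq_intros)
  from has_derivative_compose[OF this F']
  have "((\<lambda>u. F u u) has_derivative (\<lambda>h. h *\<^sub>R ?D + h *\<^sub>R G s s)) (at s)" by simp
  moreover have "G s s = of_real (z k) * pderivative k f (vscale d s z)"
    by (simp only: G_def id) (simp only: ray0)
  ultimately show ?case
    unfolding F_def Suc_ray has_vector_derivative_def by (simp add: scaleR_add_right)
qed

lemma has_vector_derivative_ray:
  assumes "smooth d f"
  shows "((\<lambda>u. f (vscale d u z)) has_vector_derivative
      (\<Sum>i<d. of_real (z i) * pderivative i f (vscale d s z))) (at s)"
proof -
  have "partial_ray d z s d u = vscale d u z" for u
    by (auto simp: partial_ray_def vscale_def)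
  with has_vector_derivative_partial_ray[OF assms order_refl, of z s] show ?thesis by simp
qed

lemma ray_derivative_le:
  "cmod (\<Sum>i<d. of_real (z i) * pderivative i f x) \<le> enorm d z * grad_norm d f x"
proof -
  have "cmod (\<Sum>i<d. of_real (z i) * pderivative i f x) \<le> (\<Sum>i<d. \<bar>z i\<bar> * \<bar>cmod (pderivative i f x)\<bar>)"
    by (rule order_trans[OF norm_sum]) (simp add: norm_mult)
  also have "\<dots> \<le> enorm d z * grad_norm d f x"
    unfolding enorm_def grad_norm_def by (rule L2_set_mult_ineq)
  finally show ?thesis .
qed

lemma enorm_vscale: "enorm d (vscale d c x) = \<bar>c\<bar> * enorm d x"
proof -
  have "L2_set (vscale d c x) {..<d} = L2_set (\<lambda>i. c * x i) {..<d}"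
    by (intro L2_set_cong) (auto simp: vscale_def)
  then show ?thesis
    by (simp add: enorm_def L2_set_def power_mult_distrib sum_distrib_left[symmetric] real_sqrt_mult)
qed

lemma enorm_pos: "x \<in> Rd d \<Longrightarrow> i < d \<Longrightarrow> x i \<noteq> 0 \<Longrightarrow> 0 < enorm d x"
  using abs_component_le_enorm[of i d x] by auto

text \<open>The right-hand side is the integral of the bound \<open>D r (1 + u r)\<^sup>-\<^sup>1\<^sup>-\<^sup>\<eta>\<close> for the speed of
  \<open>u \<mapsto> f (-u z)\<close>, where \<open>r = |z|\<close>.  The factor \<open>r\<close> from the chain rule is what makes
  the integral over the whole ray, \<open>D / \<eta>\<close>, the same for all \<open>z \<noteq> 0\<close>.\<close>

lemma ray_increment:
  assumes f: "smooth d f" and "0 < \<eta>" "0 \<le> D"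
    and grad: "\<And>x. x \<in> Rd d \<Longrightarrow> grad_norm d f x \<le> D * (1 + enorm d x) powr (- 1 - \<eta>)"
    and "0 \<le> a" "a \<le> b"
  shows "cmod (f (vscale d (- b) z) - f (vscale d (- a) z))
    \<le> D / \<eta> * ((1 + a * enorm d z) powr (- \<eta>) - (1 + b * enorm d z) powr (- \<eta>))"
proof (cases "a = b")
  case False
  then have "a < b" using \<open>a \<le> b\<close> by simp
  let ?r = "enorm d z"
  define F where "F u = f (vscale d (- u) z)" for u
  define F' where "F' u = - (\<Sum>i<d. of_real (z i) * pderivative i f (vscale d (- u) z))" for u
  define P where "P u = - (D / \<eta> * (1 + u * ?r) powr (- \<eta>))" for u
  define P' where "P' u = ?r * (D * (1 + u * ?r) powr (- 1 - \<eta>))" for u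
  have F: "(F has_vector_derivative F' u) (at u)" for u
  proof -
    have "((\<lambda>u. - u) has_vector_derivative -1) (at u)"
      by (auto intro!: derivative_eq_intros)
    from vector_diff_chain_at[OF this has_vector_derivative_ray[OF f, of z "- u"]]
    show ?thesis by (simp add: F_def[abs_def] F'_def o_def)
  qed
  have P: "(P has_vector_derivative P' u) (at u)" if "0 \<le> u" for u
  proof -
    have pos: "0 < 1 + u * ?r" using that enorm_nonneg[of d z] by (simp add: add_pos_nonneg)
    have "((\<lambda>u. 1 + u * ?r) has_real_derivative ?r) (at u)"
      by (auto intro!: derivative_eq_intros)
    from DERIV_chain2[OF has_real_derivative_powr[OF pos] this, of "- \<eta>"]
    have "((\<lambda>u. (1 + u * ?r) powr (- \<eta>)) has_real_derivative - \<eta> * (1 + u * ?r) powr (- \<eta> - 1) * ?r) (at u)" .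
    from DERIV_cmult[OF this, of "- (D / \<eta>)"]
    have "(P has_real_derivative - (D / \<eta>) * (- \<eta> * (1 + u * ?r) powr (- \<eta> - 1) * ?r)) (at u)"
      by (simp add: P_def[abs_def])
    moreover have "- (D / \<eta>) * (- \<eta> * (1 + u * ?r) powr (- \<eta> - 1) * ?r) = P' u"
      using \<open>0 < \<eta>\<close> by (simp add: P'_def minus_diff_commute)
    ultimately have "(P has_real_derivative P' u) (at u)" by simp
    then show ?thesis by (simp add: has_real_derivative_iff_has_vector_derivative)
  qed
  have "norm (F b - F a) \<le> P b - P a"
  proof (rule differentiable_bound_general[OF \<open>a < b\<close>])
    show "continuous_on {a..b} F"
      using F by (intro continuous_at_imp_continuous_on ballI) (rule has_vector_derivative_continuous)
    show "continuous_on {a..b} P"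
      using P \<open>0 \<le> a\<close> by (intro continuous_at_imp_continuous_on ballI) (rule has_vector_derivative_continuous[OF P], simp)
    show "(F has_vector_derivative F' u) (at u)" for u by (rule F)
    show "(P has_vector_derivative P' u) (at u)" if "a < u" for u using that \<open>0 \<le> a\<close> by (intro P) simp
    show "norm (F' u) \<le> P' u" if "a < u" for u
    proof -
      have "norm (F' u) \<le> ?r * grad_norm d f (vscale d (- u) z)"
        unfolding F'_def norm_minus_cancel by (rule ray_derivative_le)
      also have "\<dots> \<le> ?r * (D * (1 + u * ?r) powr (- 1 - \<eta>))"
        using grad[of "vscale d (- u) z"] that \<open>0 \<le> a\<close>
        by (intro mult_left_mono) (auto simp: enorm_nonneg enorm_vscale)
      finally show ?thesis by (simp add: P'_def)
    qed
  qed
  then show ?thesis by (simp add: F_def P_def algebra_simps)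
qed simp

text \<open>Let the far end of the previous increment tend to infinity, where \<open>f\<close> vanishes.\<close>

lemma ray_bound_pos:
  assumes f: "smooth d f" and "0 < \<eta>" "0 \<le> D"
    and grad: "\<And>x. x \<in> Rd d \<Longrightarrow> grad_norm d f x \<le> D * (1 + enorm d x) powr (- 1 - \<eta>)"
    and decay: "\<And>e. 0 < e \<Longrightarrow> \<exists>r. \<forall>x\<in>Rd d. r \<le> enorm d x \<longrightarrow> cmod (f x) < e"
    and "0 \<le> a" "0 < enorm d z"
  shows "cmod (f (vscale d (- a) z)) \<le> D / \<eta> * (1 + a * enorm d z) powr (- \<eta>)"
proof (rule field_le_epsilon)
  fix e :: real assume "0 < e"
  then obtain r where r: "\<And>x. x \<in> Rd d \<Longrightarrow> r \<le> enorm d x \<Longrightarrow> cmod (f x) < e"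
    using decay by blast
  define b where "b = max a (r / enorm d z)"
  have "a \<le> b" by (simp add: b_def)
  have "r / enorm d z \<le> b" by (simp add: b_def)
  then have "r \<le> b * enorm d z" using \<open>0 < enorm d z\<close> by (simp add: pos_divide_le_eq)
  then have "cmod (f (vscale d (- b) z)) < e"
    using \<open>a \<le> b\<close> \<open>0 \<le> a\<close> by (intro r) (auto simp: enorm_vscale)
  moreover have "cmod (f (vscale d (- b) z) - f (vscale d (- a) z))
    \<le> D / \<eta> * ((1 + a * enorm d z) powr (- \<eta>) - (1 + b * enorm d z) powr (- \<eta>))"
    using \<open>a \<le> b\<close> by (intro ray_increment assms)
  moreover have "0 \<le> D / \<eta> * (1 + b * enorm d z) powr (- \<eta>)" using assms by simp
  moreover have "cmod (f (vscale d (- a) z))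
      \<le> cmod (f (vscale d (- b) z)) + cmod (f (vscale d (- b) z) - f (vscale d (- a) z))"
    using norm_triangle_ineq4[of "f (vscale d (- b) z)" "f (vscale d (- b) z) - f (vscale d (- a) z)"] by simp
  ultimately show "cmod (f (vscale d (- a) z)) \<le> D / \<eta> * (1 + a * enorm d z) powr (- \<eta>) + e"
    by (simp add: algebra_simps)
qed

text \<open>At \<open>z = 0\<close> the ray does not leave the origin; the value there is reached as the starting point of
  a ray in another direction, which exists because \<open>1 \<le> d\<close>.\<close>

lemma ray_bound:
  assumes f: "smooth d f" and "0 < \<eta>" "0 \<le> D" and "1 \<le> d"
    and grad: "\<And>x. x \<in> Rd d \<Longrightarrow> grad_norm d f x \<le> D * (1 + enorm d x) powr (- 1 - \<eta>)"
    and decay: "\<And>e. 0 < e \<Longrightarrow> \<exists>r. \<forall>x\<in>Rd d. r \<le> enorm d x \<longrightarrow> cmod (f x) < e"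
    and "0 \<le> a"
  shows "cmod (f (vscale d (- a) z)) \<le> D / \<eta> * (1 + a * enorm d z) powr (- \<eta>)"
proof (cases "enorm d z = 0")
  case False
  then show ?thesis using enorm_nonneg[of d z] by (intro ray_bound_pos assms) auto
next
  case True
  define w where "w = (\<lambda>i\<in>{..<d}. 1::real)"
  have w: "0 < enorm d w" using \<open>1 \<le> d\<close> by (intro enorm_pos[of w d 0]) (auto simp: w_def Rd_def)
  have "z i = 0" if "i < d" for i using abs_component_le_enorm[OF that, of z] True by simp
  then have "vscale d (- a) z = vscale d (- 0) w"
    by (auto simp: vscale_def)
  then show ?thesis using ray_bound_pos[OF f assms(2,3) grad decay order_refl w] True by simp
qed

lemma ray_variation:
  assumes f: "smooth d f" and "0 < \<eta>" "0 \<le> D" and "1 \<le> d"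
    and grad: "\<And>x. x \<in> Rd d \<Longrightarrow> grad_norm d f x \<le> D * (1 + enorm d x) powr (- 1 - \<eta>)"
    and decay: "\<And>e. 0 < e \<Longrightarrow> \<exists>r. \<forall>x\<in>Rd d. r \<le> enorm d x \<longrightarrow> cmod (f x) < e"
    and s: "\<And>j. 0 \<le> s j" "\<And>j. s (Suc j) \<le> s j"
  shows "cmod (f (vscale d (- s 0) z)) + (\<Sum>j<n. cmod (f (vscale d (- s (Suc j)) z) - f (vscale d (- s j) z))) \<le> D / \<eta>"
proof -
  define P where "P u = D / \<eta> * (1 + u * enorm d z) powr (- \<eta>)" for u
  have inc: "cmod (f (vscale d (- s (Suc j)) z) - f (vscale d (- s j) z)) \<le> P (s (Suc j)) - P (s j)" for j
    using ray_increment[OF f \<open>0 < \<eta>\<close> \<open>0 \<le> D\<close> grad s(1) s(2), where z=z]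
    by (simp add: P_def norm_minus_commute algebra_simps)
  have "cmod (f (vscale d (- s 0) z)) + (\<Sum>j<n. cmod (f (vscale d (- s (Suc j)) z) - f (vscale d (- s j) z)))
      \<le> P (s 0) + (\<Sum>j<n. P (s (Suc j)) - P (s j))"
    using ray_bound[OF f assms(2-4) grad decay s(1), where z=z]
    by (intro add_mono sum_mono inc) (simp add: P_def)
  also have "\<dots> = P (s n)" unfolding sum_lessThan_telescope[of "\<lambda>j. P (s j)"] by simp
  also have "\<dots> \<le> D / \<eta> * 1"
  proof -
    have "1 \<le> (1 + s n * enorm d z) powr \<eta>"
      using assms s(1)[of n] enorm_nonneg[of d z] by (intro ge_one_powr_ge_zero) auto
    then have "(1 + s n * enorm d z) powr (- \<eta>) \<le> 1"
      unfolding powr_minus by (rule inverse_le_1_iff[THEN iffD2, OF disjI2])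
    then show ?thesis unfolding P_def using assms by (intro mult_left_mono) auto
  qed
  finally show ?thesis by simp
qed

section \<open>Complex measures and positive parts\<close>

definition signed_measure :: "'a measure \<Rightarrow> ('a set \<Rightarrow> real) \<Rightarrow> bool" where
  "signed_measure M \<nu> \<longleftrightarrow>
     (\<forall>A :: nat \<Rightarrow> 'a set. range A \<subseteq> sets M \<longrightarrow> disjoint_family A \<longrightarrow>
        (\<lambda>n. \<nu> (A n)) sums \<nu> (\<Union>n. A n))"

lemma signed_measure_Re: "complex_measure M \<mu> \<Longrightarrow> signed_measure M (\<lambda>A. Re (\<mu> A))"
  unfolding complex_measure_def signed_measure_def by (auto intro: sums_Re)

lemma signed_measure_Im: "complex_measure M \<mu> \<Longrightarrow> signed_measure M (\<lambda>A. Im (\<mu> A))"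
  unfolding complex_measure_def signed_measure_def by (auto intro: sums_Im)

lemma signed_measure_uminus: "signed_measure M \<nu> \<Longrightarrow> signed_measure M (\<lambda>A. - \<nu> A)"
  unfolding signed_measure_def by (auto intro: sums_minus)

lemma signed_measure_empty:
  assumes "signed_measure M \<nu>" shows "\<nu> {} = 0"
proof -
  have "(\<lambda>n::nat. \<nu> {}) sums \<nu> (\<Union>n::nat. {})"
    using assms[unfolded signed_measure_def, rule_format, of "\<lambda>_. {}"] by (auto simp: disjoint_family_on_def)
  then have "summable (\<lambda>n::nat. \<nu> {})" by (rule sums_summable)
  then show ?thesis by (simp add: summable_const_iff)
qed

lemma signed_measure_Un:
  assumes "signed_measure M \<nu>" "A \<in> sets M" "B \<in> sets M" "A \<inter> B = {}"
  shows "\<nu> (A \<union> B) = \<nu> A + \<nu> B"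
proof -
  have "(\<lambda>n. \<nu> (binaryset A B n)) sums \<nu> (\<Union>n. binaryset A B n)"
    using assms(2-4) by (intro assms(1)[unfolded signed_measure_def, rule_format])
      (auto simp: range_binaryset_eq disjoint_family_on_def binaryset_def)
  moreover have "(\<lambda>n. \<nu> (binaryset A B n)) sums (\<nu> A + \<nu> B)"
    by (rule binaryset_sums) (rule signed_measure_empty[OF assms(1)])
  ultimately show ?thesis by (simp add: UN_binaryset_eq sums_unique2)
qed

lemma signed_measure_Diff:
  assumes "signed_measure M \<nu>" "A \<in> sets M" "B \<in> sets M" "A \<subseteq> B"
  shows "\<nu> (B - A) = \<nu> B - \<nu> A"
  using signed_measure_Un[OF assms(1,2), of "B - A"] assms by (auto simp: Un_absorb1)

text \<open>If \<open>\<nu>\<close> is unbounded on the subsets of \<open>E\<close>, remove from \<open>E\<close> one of two complementary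
  pieces of large charge so that it stays unbounded on the rest; the removed pieces are disjoint
  and their charges do not tend to \<open>0\<close>.\<close>

lemma signed_measure_bounded:
  assumes nu: "signed_measure M \<nu>"
  obtains C where "\<And>A. A \<in> sets M \<Longrightarrow> \<bar>\<nu> A\<bar> \<le> C"
proof (rule ccontr)
  assume contra: "\<not> thesis"
  define bad where "bad E \<longleftrightarrow> E \<in> sets M \<and> (\<forall>C. \<exists>A\<in>sets M. A \<subseteq> E \<and> C < \<bar>\<nu> A\<bar>)" for E
  have "bad (space M)"
    unfolding bad_def
  proof (intro conjI allI)
    fix C
    have "\<not> (\<forall>A\<in>sets M. \<bar>\<nu> A\<bar> \<le> C)" using contra that by blast
    then show "\<exists>A\<in>sets M. A \<subseteq> space M \<and> C < \<bar>\<nu> A\<bar>"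
      using sets.sets_into_space[of _ M] by (meson not_le)
  qed auto
  have step: "\<exists>E'. bad E' \<and> E' \<subseteq> E \<and> 1 \<le> \<bar>\<nu> (E - E')\<bar>" if bad: "bad E" for E
  proof -
    have E: "E \<in> sets M" using bad by (simp add: bad_def)
    obtain A where A: "A \<in> sets M" "A \<subseteq> E" and big: "1 + \<bar>\<nu> E\<bar> < \<bar>\<nu> A\<bar>"
      using bad[unfolded bad_def, THEN conjunct2, rule_format, of "1 + \<bar>\<nu> E\<bar>"] by blast
    have d: "\<nu> (E - A) = \<nu> E - \<nu> A" by (rule signed_measure_Diff[OF nu A(1) E A(2)])
    have "bad A \<or> bad (E - A)"
    proof (rule ccontr)
      assume not_bad: "\<not> (bad A \<or> bad (E - A))"
      have bounded: "\<exists>C. \<forall>B. B \<in> sets M \<longrightarrow> B \<subseteq> X \<longrightarrow> \<bar>\<nu> B\<bar> \<le> C" if "\<not> bad X" "X \<in> sets M" for X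
        using that unfolding bad_def by (simp add: not_less) blast
      obtain C1 where C1: "\<And>B. B \<in> sets M \<Longrightarrow> B \<subseteq> A \<Longrightarrow> \<bar>\<nu> B\<bar> \<le> C1"
        using bounded[of A] not_bad A by blast
      obtain C2 where C2: "\<And>B. B \<in> sets M \<Longrightarrow> B \<subseteq> E - A \<Longrightarrow> \<bar>\<nu> B\<bar> \<le> C2"
        using bounded[of "E - A"] not_bad A E by blast
      obtain B where B: "B \<in> sets M" "B \<subseteq> E" "C1 + C2 < \<bar>\<nu> B\<bar>"
        using bad[unfolded bad_def, THEN conjunct2, rule_format, of "C1 + C2"] by blast
      have "\<nu> B = \<nu> (B \<inter> A) + \<nu> (B - A)"
        using signed_measure_Un[OF nu, of "B \<inter> A" "B - A"] A B by (auto simp: Int_Diff_Un)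
      moreover have "\<bar>\<nu> (B \<inter> A)\<bar> \<le> C1" "\<bar>\<nu> (B - A)\<bar> \<le> C2"
        using A B by (auto intro!: C1 C2)
      ultimately show False using B(3) by linarith
    qed
    then show ?thesis
    proof
      assume "bad A"
      moreover have "1 \<le> \<bar>\<nu> (E - A)\<bar>" using d big by linarith
      ultimately show ?thesis using A by blast
    next
      assume "bad (E - A)"
      moreover have "E - (E - A) = A" using A by blast
      then have "1 \<le> \<bar>\<nu> (E - (E - A))\<bar>" using big by simp
      ultimately show ?thesis by blast
    qed
  qed
  have "\<exists>F. \<forall>n. bad (F n) \<and> (F (Suc n) \<subseteq> F n \<and> 1 \<le> \<bar>\<nu> (F n - F (Suc n))\<bar>)"
    by (rule dependent_nat_choice[of "\<lambda>_. bad" "\<lambda>_ E E'. E' \<subseteq> E \<and> 1 \<le> \<bar>\<nu> (E - E')\<bar>"])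
      (use \<open>bad (space M)\<close> step in blast)+
  then obtain F where F: "\<And>n. bad (F n)" "\<And>n. F (Suc n) \<subseteq> F n \<and> 1 \<le> \<bar>\<nu> (F n - F (Suc n))\<bar>"
    by blast
  have dec: "F n \<subseteq> F m" if "m \<le> n" for m n
    using that F(2) by (induction rule: dec_induct) auto
  have "disjoint_family (\<lambda>n. F n - F (Suc n))"
    unfolding disjoint_family_on_def
  proof (intro ballI impI)
    fix m n :: nat assume "m \<noteq> n"
    then consider "Suc m \<le> n" | "Suc n \<le> m" by linarith
    then show "(F m - F (Suc m)) \<inter> (F n - F (Suc n)) = {}"
      by cases (use dec in blast)+
  qed
  then have "(\<lambda>n. \<nu> (F n - F (Suc n))) sums \<nu> (\<Union>n. F n - F (Suc n))"
    using F(1) by (intro nu[unfolded signed_measure_def, rule_format]) (auto simp: bad_def)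
  then have "(\<lambda>n. \<nu> (F n - F (Suc n))) \<longlonglongrightarrow> 0"
    by (intro summable_LIMSEQ_zero) (rule sums_summable)
  then have "eventually (\<lambda>n. \<bar>\<nu> (F n - F (Suc n))\<bar> < 1) sequentially"
    using order_tendstoD(2)[OF tendsto_rabs_zero, of _ sequentially 1] by simp
  then obtain n where "\<bar>\<nu> (F n - F (Suc n))\<bar> < 1" by (auto simp: eventually_sequentially)
  then show False using F(2)[of n] by linarith
qed

lemma sets_pos_part [simp, measurable_cong]: "sets (pos_part M \<nu>) = sets M"
  by (simp add: pos_part_def sets.space_closed)

lemma space_pos_part [simp]: "space (pos_part M \<nu>) = space M"
  by (simp add: pos_part_def space_measure_of_conv)

text \<open>The supremum over subsets is countably additive: a subset of a disjoint union is the union of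
  its pieces, which bounds the supremum by the sum, and competitors on finitely many disjoint sets
  can be united, which gives the converse.\<close>

lemma emeasure_pos_part:
  assumes nu: "signed_measure M \<nu>" and E: "E \<in> sets M"
  shows "emeasure (pos_part M \<nu>) E = (SUP A\<in>{A \<in> sets M. A \<subseteq> E}. ennreal (\<nu> A))"
proof -
  define P where "P E = (SUP A\<in>{A \<in> sets M. A \<subseteq> E}. ennreal (\<nu> A))" for E
  have up: "ennreal (\<nu> A) \<le> P E" if "A \<in> sets M" "A \<subseteq> E" for A E
    unfolding P_def using that by (intro SUP_upper) auto
  have mono: "P E \<le> P E'" if "E \<subseteq> E'" for E E'
    unfolding P_def using that by (intro SUP_subset_mono) auto
  have "P {} = 0"
  proof -
    have "{A \<in> sets M. A \<subseteq> {}} = {{}}" by auto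
    then show ?thesis by (simp add: P_def signed_measure_empty[OF nu])
  qed
  have add2: "P E + P E' \<le> P (E \<union> E')" if "E \<in> sets M" "E' \<in> sets M" "E \<inter> E' = {}" for E E'
  proof -
    have ne: "{A \<in> sets M. A \<subseteq> X} \<noteq> {}" for X by auto
    have *: "ennreal (\<nu> A) + ennreal (\<nu> A') \<le> P (E \<union> E')"
      if "A \<in> sets M" "A \<subseteq> E" "A' \<in> sets M" "A' \<subseteq> E'" for A A'
    proof -
      have "A \<inter> A' = {}" using that \<open>E \<inter> E' = {}\<close> by blast
      then have eq: "\<nu> (A \<union> A') = \<nu> A + \<nu> A'" using that by (intro signed_measure_Un[OF nu])
      consider "\<nu> A \<le> 0" | "\<nu> A' \<le> 0" | "0 \<le> \<nu> A" "0 \<le> \<nu> A'" by linarith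
      then show ?thesis
      proof cases
        case 1
        then show ?thesis using up[of A' "E \<union> E'"] that by (auto simp: ennreal_neg)
      next
        case 2
        then show ?thesis using up[of A "E \<union> E'"] that by (auto simp: ennreal_neg)
      next
        case 3
        then have "ennreal (\<nu> A) + ennreal (\<nu> A') = ennreal (\<nu> (A \<union> A'))" by (simp add: eq)
        also have "\<dots> \<le> P (E \<union> E')" using that by (intro up) auto
        finally show ?thesis .
      qed
    qed
    have "P E + P E' = (SUP A'\<in>{A' \<in> sets M. A' \<subseteq> E'}. SUP A\<in>{A \<in> sets M. A \<subseteq> E}. ennreal (\<nu> A) + ennreal (\<nu> A'))"
      unfolding P_def by (simp add: ennreal_SUP_add_left[OF ne, symmetric] ennreal_SUP_add_right[OF ne])
    also have "\<dots> \<le> P (E \<union> E')" by (intro SUP_least *) auto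
    finally show ?thesis .
  qed
  have "countably_additive (sets M) P"
  proof (rule countably_additiveI)
    fix A :: "nat \<Rightarrow> 'a set"
    assume A: "range A \<subseteq> sets M" "disjoint_family A" "(\<Union>n. A n) \<in> sets M"
    have "(\<Sum>n<N. P (A n)) \<le> P (\<Union>n<N. A n)" for N
    proof (induction N)
      case (Suc N)
      have "A N \<inter> A n = {}" if "n < N" for n
        using A(2) that unfolding disjoint_family_on_def by simp
      then have "A N \<inter> (\<Union>n<N. A n) = {}" by blast
      then have "P (A N) + P (\<Union>n<N. A n) \<le> P (A N \<union> (\<Union>n<N. A n))"
        using A(1) by (intro add2) auto
      moreover have "A N \<union> (\<Union>n<N. A n) = (\<Union>n<Suc N. A n)" by (auto simp: less_Suc_eq)
      ultimately have "P (A N) + P (\<Union>n<N. A n) \<le> P (\<Union>n<Suc N. A n)" by simp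
      moreover have "(\<Sum>n<Suc N. P (A n)) \<le> P (A N) + P (\<Union>n<N. A n)"
        using add_left_mono[OF Suc.IH, of "P (A N)"] by (simp add: add.commute)
      ultimately show ?case by (rule order_trans[rotated])
    qed (simp add: \<open>P {} = 0\<close>)
    then have "(\<Sum>n<N. P (A n)) \<le> P (\<Union>n. A n)" for N
      by (rule order_trans) (intro mono, auto)
    then have le: "(\<Sum>n. P (A n)) \<le> P (\<Union>n. A n)" by (intro suminf_le_const summableI)
    have ge: "P (\<Union>n. A n) \<le> (\<Sum>n. P (A n))"
      unfolding P_def[of "\<Union>n. A n"]
    proof (rule SUP_least)
      fix B assume "B \<in> {B \<in> sets M. B \<subseteq> (\<Union>n. A n)}"
      then have B: "B \<in> sets M" "(\<Union>n. B \<inter> A n) = B" by auto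
      have "(\<lambda>n. \<nu> (B \<inter> A n)) sums \<nu> (\<Union>n. B \<inter> A n)"
        using A(1,2) B(1) by (intro nu[unfolded signed_measure_def, rule_format])
          (auto simp: disjoint_family_on_def)
      then have sums: "(\<lambda>n. \<nu> (B \<inter> A n)) sums \<nu> B" by (simp only: B(2))
      have "ennreal (\<Sum>n<N. \<nu> (B \<inter> A n)) \<le> (\<Sum>n. P (A n))" for N
      proof -
        have "ennreal (\<Sum>n<N. \<nu> (B \<inter> A n)) \<le> ennreal (\<Sum>n<N. max 0 (\<nu> (B \<inter> A n)))"
          by (intro ennreal_leI sum_mono) auto
        also have "\<dots> = (\<Sum>n<N. ennreal (\<nu> (B \<inter> A n)))"
        proof -
          have "ennreal (max 0 u) = ennreal u" for u by (simp add: max_def ennreal_neg)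
          then show ?thesis
            using sum_ennreal[of "{..<N}" "\<lambda>n. max 0 (\<nu> (B \<inter> A n))"] by simp
        qed
        also have "\<dots> \<le> (\<Sum>n<N. P (A n))" using A(1) B(1) by (intro sum_mono up) auto
        also have "\<dots> \<le> (\<Sum>n. P (A n))" by (intro sum_le_suminf) auto
        finally show ?thesis .
      qed
      moreover have "(\<lambda>N. ennreal (\<Sum>n<N. \<nu> (B \<inter> A n))) \<longlonglongrightarrow> ennreal (\<nu> B)"
        using sums unfolding sums_def by (intro tendsto_ennrealI)
      ultimately show "ennreal (\<nu> B) \<le> (\<Sum>n. P (A n))" by (intro LIMSEQ_le_const2) auto
    qed
    show "(\<Sum>n. P (A n)) = P (\<Union>n. A n)" by (rule antisym[OF le ge])
  qed
  moreover have "positive (sets M) P" using \<open>P {} = 0\<close> by (simp add: positive_def)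
  ultimately show ?thesis
    using emeasure_measure_of_sigma[OF sets.sigma_algebra_axioms _ _ E, of P]
    unfolding pos_part_def P_def by blast
qed

lemma finite_measure_pos_part:
  assumes nu: "signed_measure M \<nu>"
  shows "finite_measure (pos_part M \<nu>)"
proof
  obtain C where C: "\<And>A. A \<in> sets M \<Longrightarrow> \<bar>\<nu> A\<bar> \<le> C"
    using signed_measure_bounded[OF nu] by blast
  have "emeasure (pos_part M \<nu>) (space M) \<le> ennreal C"
    unfolding emeasure_pos_part[OF nu sets.top]
    by (intro SUP_least ennreal_leI) (use C in \<open>auto dest: abs_le_D1\<close>)
  then show "emeasure (pos_part M \<nu>) (space (pos_part M \<nu>)) \<noteq> \<infinity>"
    by (auto simp: top_unique)
qed

lemma signed_measure_image:
  assumes nu: "signed_measure M \<nu>"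
    and T: "bij_betw T (space M) (space M)" and im: "\<And>A. A \<in> sets M \<Longrightarrow> T ` A \<in> sets M"
  shows "signed_measure M (\<lambda>A. \<nu> (T ` A))"
  unfolding signed_measure_def
proof (intro allI impI)
  fix A :: "nat \<Rightarrow> 'a set" assume A: "range A \<subseteq> sets M" "disjoint_family A"
  have "disjoint_family (\<lambda>n. T ` A n)"
    unfolding disjoint_family_on_def
  proof (intro ballI impI)
    fix m n :: nat assume "m \<noteq> n"
    have "A m \<subseteq> space M" "A n \<subseteq> space M" using A(1) sets.sets_into_space by blast+
    then have "T ` A m \<inter> T ` A n = T ` (A m \<inter> A n)"
      using T by (intro inj_on_image_Int[symmetric]) (auto simp: bij_betw_def)
    then show "T ` A m \<inter> T ` A n = {}" using A(2) \<open>m \<noteq> n\<close> by (auto simp: disjoint_family_on_def)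
  qed
  then have "(\<lambda>n. \<nu> (T ` A n)) sums \<nu> (\<Union>n. T ` A n)"
    using A(1) im by (intro nu[unfolded signed_measure_def, rule_format]) auto
  then show "(\<lambda>n. \<nu> (T ` A n)) sums \<nu> (T ` (\<Union>n. A n))" by (simp add: image_UN)
qed

text \<open>Push-forward under a bimeasurable bijection commutes with taking positive parts, because it
  permutes the competitors in the supremum.\<close>

lemma pos_part_image:
  assumes nu: "signed_measure M \<nu>"
    and T: "T \<in> measurable M M" and S: "S \<in> measurable M M"
    and TS: "\<And>x. x \<in> space M \<Longrightarrow> T (S x) = x" and ST: "\<And>x. x \<in> space M \<Longrightarrow> S (T x) = x"
  shows "pos_part M (\<lambda>A. \<nu> (T ` A)) = distr (pos_part M \<nu>) M S"
proof (rule measure_eqI)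
  have sp: "T x \<in> space M" "S x \<in> space M" if "x \<in> space M" for x
    using that T S by (auto dest: measurable_space)
  have bij: "bij_betw T (space M) (space M)"
    by (rule bij_betwI[where g=S]) (use sp TS ST in auto)
  have im: "f ` A = g -` A \<inter> space M"
    if "A \<subseteq> space M" "\<And>x. x \<in> space M \<Longrightarrow> f (g x) = x" "\<And>x. x \<in> space M \<Longrightarrow> g (f x) = x"
      "\<And>x. x \<in> space M \<Longrightarrow> f x \<in> space M" for A f g
  proof safe
    fix x assume "x \<in> A"
    then have "x \<in> space M" using that(1) by blast
    then show "f x \<in> space M" using that(4) by blast
    show "f x \<in> g -` A" using that(3)[OF \<open>x \<in> space M\<close>] \<open>x \<in> A\<close> by simp
  next
    fix x assume "x \<in> space M" "g x \<in> A"
    then show "x \<in> f ` A" using that(2)[of x] by (metis imageI)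
  qed
  have imT: "T ` A = S -` A \<inter> space M" if "A \<subseteq> space M" for A
    by (rule im[OF that TS ST sp(1)])
  have imS: "S ` A = T -` A \<inter> space M" if "A \<subseteq> space M" for A
    by (rule im[OF that ST TS sp(2)])
  have Ts: "T ` A \<in> sets M" if "A \<in> sets M" for A
    using that measurable_sets[OF S that] by (simp add: imT sets.sets_into_space)
  have Ss: "S ` A \<in> sets M" if "A \<in> sets M" for A
    using that measurable_sets[OF T that] by (simp add: imS sets.sets_into_space)
  fix E assume "E \<in> sets (pos_part M (\<lambda>A. \<nu> (T ` A)))"
  then have E: "E \<in> sets M" by simp
  have img: "(\<lambda>A. T ` A) ` {A \<in> sets M. A \<subseteq> E} = {A \<in> sets M. A \<subseteq> T ` E}"
  proof safe
    fix A assume A: "A \<in> sets M" "A \<subseteq> T ` E"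
    have "A = T ` (S ` A)" using sets.sets_into_space[OF A(1)] TS by (auto simp: image_image subset_iff)
    moreover have "S ` A \<subseteq> E"
    proof
      fix y assume "y \<in> S ` A"
      then obtain x where x: "x \<in> E" "y = S (T x)" using A(2) by blast
      then show "y \<in> E" using sets.sets_into_space[OF E] ST[of x] by auto
    qed
    ultimately show "A \<in> (\<lambda>A. T ` A) ` {A \<in> sets M. A \<subseteq> E}" using Ss[OF A(1)] by blast
  qed (use Ts in auto)
  have "(SUP A\<in>{A \<in> sets M. A \<subseteq> E}. ennreal (\<nu> (T ` A))) = (SUP A\<in>{A \<in> sets M. A \<subseteq> T ` E}. ennreal (\<nu> A))"
    unfolding img[symmetric] image_image ..
  moreover have "emeasure (distr (pos_part M \<nu>) M S) E = emeasure (pos_part M \<nu>) (T ` E)"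
  proof -
    have "S \<in> measurable (pos_part M \<nu>) M"
      using S measurable_cong_sets[OF sets_pos_part refl] by blast
    then show ?thesis using E by (simp add: emeasure_distr imT sets.sets_into_space)
  qed
  ultimately show "emeasure (pos_part M (\<lambda>A. \<nu> (T ` A))) E = emeasure (distr (pos_part M \<nu>) M S) E"
    by (simp add: emeasure_pos_part[OF nu Ts[OF E]] emeasure_pos_part[OF signed_measure_image[OF nu bij Ts] E])
qed simp

section \<open>Convolution as multiplication\<close>

text \<open>The standard unitary character of the real line.\<close>

definition chr :: "real \<Rightarrow> complex" where
  "chr u = exp (- 2 * of_real pi * \<i> * of_real u)"

lemma norm_chr [simp]: "cmod (chr u) = 1"
  by (simp add: chr_def norm_exp_eq_Re)

lemma chr_add: "chr (u + v) = chr u * chr v"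
  by (simp add: chr_def exp_add[symmetric] algebra_simps)

lemma chr_measurable [measurable]: "chr \<in> borel_measurable borel"
  unfolding chr_def by (intro borel_measurable_continuous_onI continuous_intros)

lemma fourier_chr: "fourier d f y = (\<integral>x. chr (dot d x y) * f x \<partial>leb d)"
  by (simp add: fourier_def chr_def)

lemma vscale_measurable [measurable]: "vscale d t \<in> leb d \<rightarrow>\<^sub>M leb d"
  unfolding vscale_def leb_def by measurable

lemma vminus_measurable [measurable]: "vminus d x \<in> leb d \<rightarrow>\<^sub>M leb d"
  unfolding vminus_def leb_def by measurable

lemma vscale_vscale_inverse: "c \<noteq> 0 \<Longrightarrow> x \<in> Rd d \<Longrightarrow> vscale d c (vscale d (inverse c) x) = x"
  by (auto simp: vscale_def Rd_def PiE_def extensional_def)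

lemma vscale_inverse_vscale: "c \<noteq> 0 \<Longrightarrow> x \<in> Rd d \<Longrightarrow> vscale d (inverse c) (vscale d c x) = x"
  using vscale_vscale_inverse[of "inverse c" x d] by simp

lemma dot_vminus_vscale:
  "dot d z (vminus d x (vscale d t y)) = dot d z x + dot d y (vscale d (- t) z)"
  by (simp add: dot_def vminus_def vscale_def sum.distrib[symmetric] algebra_simps)

lemma fourier_measurable [measurable]:
  assumes [measurable]: "f \<in> borel_measurable (leb d)"
  shows "fourier d f \<in> borel_measurable (leb d)"
proof -
  interpret sigma_finite_measure "leb d" by (rule sigma_finite_leb)
  have "(\<lambda>(y, x). chr (dot d x y) * f x) \<in> borel_measurable (leb d \<Otimes>\<^sub>M leb d)"
    unfolding dot_def by measurable
  then have "(\<lambda>y. \<integral>x. chr (dot d x y) * f x \<partial>leb d) \<in> borel_measurable (leb d)"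
    by (rule borel_measurable_lebesgue_integral)
  then show ?thesis by (simp add: fourier_chr[abs_def])
qed

lemma signed_integral_dilate:
  assumes nu: "signed_measure (leb d) \<nu>" and "0 < t"
    and [measurable]: "g \<in> borel_measurable (leb d)"
  shows "signed_integral (leb d) (\<lambda>A. \<nu> (vscale d (inverse t) ` A)) g
    = signed_integral (leb d) \<nu> (\<lambda>y. g (vscale d t y))"
proof -
  have *: "(\<integral>y. g y \<partial>pos_part (leb d) (\<lambda>A. \<rho> (vscale d (inverse t) ` A)))
      = (\<integral>y. g (vscale d t y) \<partial>pos_part (leb d) \<rho>)" if rho: "signed_measure (leb d) \<rho>" for \<rho>
  proof -
    have "pos_part (leb d) (\<lambda>A. \<rho> (vscale d (inverse t) ` A)) = distr (pos_part (leb d) \<rho>) (leb d) (vscale d t)"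
      using \<open>0 < t\<close> by (intro pos_part_image[OF rho])
        (auto simp: space_leb vscale_vscale_inverse vscale_inverse_vscale)
    moreover have "vscale d t \<in> measurable (pos_part (leb d) \<rho>) (leb d)"
      using vscale_measurable measurable_cong_sets[OF sets_pos_part refl] by blast
    ultimately show ?thesis by (simp add: integral_distr)
  qed
  show ?thesis
    unfolding signed_integral_def using *[OF nu] *[OF signed_measure_uminus[OF nu]] by simp
qed

text \<open>The integrand has modulus \<open>|f z|\<close>, which is integrable against the product with a finite measure.
  The identity is first stated for a positive measure \<open>P\<close>; a complex measure is a
  combination of four of these.\<close>

lemma fourier_convolution_positive:
  assumes fin: "finite_measure P" and P [measurable_cong]: "sets P = sets (leb d)"
    and f: "integrable (leb d) f"
  defines "m \<equiv> \<lambda>z. \<integral>y. chr (dot d y z) \<partial>P"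
  shows "integrable (leb d) (\<lambda>z. chr (dot d z x) * (f z * m (vscale d (- t) z)))"
    and "(\<integral>y. fourier d f (vminus d x (vscale d t y)) \<partial>P)
      = (\<integral>z. chr (dot d z x) * (f z * m (vscale d (- t) z)) \<partial>leb d)"
proof -
  interpret P: finite_measure P by fact
  interpret L: sigma_finite_measure "leb d" by (rule sigma_finite_leb)
  interpret PL: pair_sigma_finite P "leb d" ..
  note [measurable] = borel_measurable_integrable[OF f]
  define G where "G y z = chr (dot d z x) * (f z * chr (dot d y (vscale d (- t) z)))" for y z
  have "dot d y (vscale d (- t) z) = (\<Sum>i<d. y i * (- t * z i))" for y z
    by (simp add: dot_def vscale_def)
  then have G_alt: "G y z = chr (\<Sum>i<d. z i * x i) * (f z * chr (\<Sum>i<d. y i * (- t * z i)))" for y z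
    by (simp add: G_def dot_def)
  have Gm [measurable]: "(\<lambda>(y, z). G y z) \<in> borel_measurable (P \<Otimes>\<^sub>M leb d)"
    unfolding G_alt by measurable
  have nG: "norm (G y z) = norm (f z)" for y z by (simp add: G_def norm_mult)
  have "integrable (P \<Otimes>\<^sub>M leb d) (\<lambda>(y, z). G y z)"
  proof (rule PL.Fubini_integrable[OF Gm])
    show "integrable P (\<lambda>y. \<integral>z. norm (case (y, z) of (y, z) \<Rightarrow> G y z) \<partial>leb d)"
      by (simp add: nG)
    have "integrable (leb d) (\<lambda>z. G y z)" if "y \<in> space P" for y
    proof (rule Bochner_Integration.integrable_bound[OF f])
      show "(\<lambda>z. G y z) \<in> borel_measurable (leb d)"
        unfolding G_alt by measurable
    qed (simp add: nG)
    then show "AE y in P. integrable (leb d) (\<lambda>z. case (y, z) of (y, z) \<Rightarrow> G y z)" by auto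
  qed
  note int = this
  have inner: "(\<integral>y. G y z \<partial>P) = chr (dot d z x) * (f z * m (vscale d (- t) z))" for z
    by (simp add: G_def m_def)
  show "integrable (leb d) (\<lambda>z. chr (dot d z x) * (f z * m (vscale d (- t) z)))"
    using PL.integrable_snd[OF int] by (simp add: inner)
  have "(\<integral>y. fourier d f (vminus d x (vscale d t y)) \<partial>P) = (\<integral>y. (\<integral>z. G y z \<partial>leb d) \<partial>P)"
    by (simp add: fourier_chr G_def dot_vminus_vscale chr_add mult_ac)
  also have "\<dots> = (\<integral>z. (\<integral>y. G y z \<partial>P) \<partial>leb d)"
    by (rule PL.Fubini_integral[OF int, symmetric])
  finally show "(\<integral>y. fourier d f (vminus d x (vscale d t y)) \<partial>P)
      = (\<integral>z. chr (dot d z x) * (f z * m (vscale d (- t) z)) \<partial>leb d)"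
    by (simp add: inner)
qed

text \<open>Each of the four positive parts of \<open>\<mu>\<close> multiplies \<open>f\<close> by its own transform at \<open>- t z\<close>, where the
  sign comes from \<open>x - y\<close> in the convolution; linearity recombines them.\<close>

lemma convolution_dilate_eq_fourier:
  assumes mu: "complex_measure (leb d) \<mu>" and f: "integrable (leb d) f" and "0 < t"
  shows "convolution d (fourier d f) (dilate d t \<mu>) x
    = fourier d (\<lambda>z. f z * fourier_measure d \<mu> (vscale d (- t) z)) x"
proof -
  note [measurable] = borel_measurable_integrable[OF f]
  let ?Re = "\<lambda>A. Re (\<mu> A)" and ?Im = "\<lambda>A. Im (\<mu> A)"
  note sm = signed_measure_Re[OF mu] signed_measure_Im[OF mu]
    signed_measure_uminus[OF signed_measure_Re[OF mu]] signed_measure_uminus[OF signed_measure_Im[OF mu]]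
  define m where "m \<nu> z = (\<integral>y. chr (dot d y z) \<partial>pos_part (leb d) \<nu>)" for \<nu> z
  define I where "I \<nu> = (\<integral>y. fourier d f (vminus d x (vscale d t y)) \<partial>pos_part (leb d) \<nu>)" for \<nu>
  define J where "J \<nu> z = chr (dot d z x) * (f z * m \<nu> (vscale d (- t) z))" for \<nu> z
  have J: "integrable (leb d) (J \<nu>)" and IJ: "I \<nu> = (\<integral>z. J \<nu> z \<partial>leb d)" if "signed_measure (leb d) \<nu>" for \<nu>
    using fourier_convolution_positive[OF finite_measure_pos_part[OF that] sets_pos_part f]
    unfolding J_def I_def m_def by auto
  have meas: "(\<lambda>y. fourier d f (vminus d x y)) \<in> borel_measurable (leb d)" by measurable
  have "convolution d (fourier d f) (dilate d t \<mu>) x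
      = (I ?Re - I (\<lambda>A. - ?Re A)) + \<i> * (I ?Im - I (\<lambda>A. - ?Im A))"
    unfolding convolution_def complex_integral_def dilate_def
      signed_integral_dilate[OF sm(1) \<open>0 < t\<close> meas] signed_integral_dilate[OF sm(2) \<open>0 < t\<close> meas]
    by (simp add: signed_integral_def I_def)
  also have "\<dots> = (\<integral>z. (J ?Re z - J (\<lambda>A. - ?Re A) z) + \<i> * (J ?Im z - J (\<lambda>A. - ?Im A) z) \<partial>leb d)"
    using J[OF sm(1)] J[OF sm(2)] J[OF sm(3)] J[OF sm(4)]
    by (simp add: IJ sm)
  also have "\<dots> = fourier d (\<lambda>z. f z * fourier_measure d \<mu> (vscale d (- t) z)) x"
    unfolding fourier_chr
    by (intro Bochner_Integration.integral_cong refl)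
       (simp add: fourier_measure_def complex_integral_def signed_integral_def J_def m_def chr_def algebra_simps)
  finally show ?thesis .
qed

section \<open>Restriction of smooth multiples of Schwartz functions\<close>

lemma enn_powr_ennreal: "0 \<le> a \<Longrightarrow> enn_powr (ennreal a) r = ennreal (a powr r)"
  by (simp add: enn_powr_def)

lemma enn_powr_2: "0 \<le> a \<Longrightarrow> enn_powr (ennreal a) 2 = ennreal (a\<^sup>2)"
  by (simp add: enn_powr_ennreal)

lemma enn_powr_half_le_iff:
  assumes "0 \<le> c"
  shows "enn_powr I (1 / 2) \<le> ennreal c \<longleftrightarrow> I \<le> ennreal (c\<^sup>2)"
proof (cases I)
  case (real i)
  have "i powr (1 / 2) \<le> c \<longleftrightarrow> i \<le> c\<^sup>2"
    using real_sqrt_le_iff[of i "c\<^sup>2"] real assms by (simp add: powr_half_sqrt)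
  then show ?thesis using real assms by (simp add: enn_powr_ennreal ennreal_le_iff)
qed (simp add: enn_powr_def top_unique)

lemma Lp_norm_cmod:
  assumes "integrable M (\<lambda>x. cmod (h x) powr p)"
  shows "Lp_norm p M (\<lambda>x. ennreal (cmod (h x))) = ennreal ((\<integral>x. cmod (h x) powr p \<partial>M) powr (1 / p))"
proof -
  have "(\<integral>\<^sup>+x. enn_powr (ennreal (cmod (h x))) p \<partial>M) = ennreal (\<integral>x. cmod (h x) powr p \<partial>M)"
    by (simp add: enn_powr_ennreal nn_integral_eq_integral[OF assms])
  then show ?thesis by (simp add: Lp_norm_def enn_powr_ennreal)
qed

lemma Lp_norm_2_cmod_le_iff:
  "0 \<le> c \<Longrightarrow> Lp_norm 2 M (\<lambda>x. ennreal (cmod (h x))) \<le> ennreal c \<longleftrightarrow>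
    (\<integral>\<^sup>+x. ennreal ((cmod (h x))\<^sup>2) \<partial>M) \<le> ennreal (c\<^sup>2)"
  by (simp add: Lp_norm_def enn_powr_half_le_iff enn_powr_2)

lemma square_powr:
  fixes p :: real
  shows "0 \<le> J \<Longrightarrow> (C * J powr (1 / p))\<^sup>2 = C\<^sup>2 * J powr (2 / p)"
  using powr_add[of J "1 / p" "1 / p"] by (simp add: power_mult_distrib power2_eq_square)

lemma sets_sphere_measure [simp, measurable_cong]: "sets (sphere_measure d) = sets (leb d)"
  by (simp add: sphere_measure_def)

lemma powr_mult_bounded_integrable:
  assumes f: "schwartz d f" and p: "1 \<le> p" and [measurable]: "v \<in> borel_measurable (leb d)"
    and bound: "\<And>x. x \<in> Rd d \<Longrightarrow> 0 \<le> v x" "\<And>x. x \<in> Rd d \<Longrightarrow> v x \<le> B"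
  shows "integrable (leb d) (\<lambda>x. (cmod (f x) * v x) powr p)"
proof (rule Bochner_Integration.integrable_bound)
  note [measurable] = borel_measurable_integrable[OF schwartz_integrable[OF f]]
  show "integrable (leb d) (\<lambda>x. B powr p * cmod (f x) powr p)"
    using schwartz_powr_integrable[OF f p] by simp
  show "(\<lambda>x. (cmod (f x) * v x) powr p) \<in> borel_measurable (leb d)" by measurable
  have "(cmod (f x) * v x) powr p \<le> B powr p * cmod (f x) powr p" if "x \<in> Rd d" for x
  proof -
    have "v x powr p \<le> B powr p" using bound[OF that] p by (intro powr_mono2) auto
    then show ?thesis by (simp add: powr_mult mult.commute mult_right_mono)
  qed
  then show "AE x in leb d. norm ((cmod (f x) * v x) powr p) \<le> norm (B powr p * cmod (f x) powr p)"
    by (intro AE_I2) (simp add: space_leb)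
qed

lemma integrable_mult_bounded:
  assumes f: "integrable (leb d) f" and [measurable]: "u \<in> borel_measurable (leb d)"
    and bound: "\<And>x. x \<in> Rd d \<Longrightarrow> cmod (u x) \<le> B"
  shows "integrable (leb d) (\<lambda>x. f x * u x)"
proof (rule Bochner_Integration.integrable_bound)
  note [measurable] = borel_measurable_integrable[OF f]
  show "integrable (leb d) (\<lambda>x. of_real B * f x)" using f by simp
  show "(\<lambda>x. f x * u x) \<in> borel_measurable (leb d)" by measurable
  have "norm (f x * u x) \<le> norm (of_real B * f x)" if "x \<in> Rd d" for x
    using mult_right_mono[OF order_trans[OF bound[OF that] abs_ge_self], of "cmod (f x)"]
    by (simp add: norm_mult mult.commute)
  then show "AE x in leb d. norm (f x * u x) \<le> norm (of_real B * f x)"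
    by (intro AE_I2) (simp add: space_leb)
qed

lemma restriction_schwartz:
  assumes restr: "restriction_estimate d p C" and "0 \<le> C" "1 \<le> p" and h: "schwartz d h"
  shows "(\<integral>\<^sup>+y. ennreal ((cmod (fourier d h y))\<^sup>2) \<partial>sphere_measure d)
    \<le> ennreal (C\<^sup>2 * (\<integral>x. cmod (h x) powr p \<partial>leb d) powr (2 / p))"
proof -
  let ?J = "\<integral>x. cmod (h x) powr p \<partial>leb d"
  have J: "0 \<le> ?J" by (intro integral_nonneg_AE) auto
  have "Lp_norm 2 (sphere_measure d) (\<lambda>y. ennreal (cmod (fourier d h y))) \<le> ennreal (C * ?J powr (1 / p))"
    using restr[unfolded restriction_estimate_def, rule_format, OF h] J \<open>0 \<le> C\<close>
    unfolding Lp_norm_cmod[OF schwartz_powr_integrable[OF h \<open>1 \<le> p\<close>]]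
    by (simp add: ennreal_mult)
  then show ?thesis
    using \<open>0 \<le> C\<close> J by (simp add: Lp_norm_2_cmod_le_iff square_powr)
qed

text \<open>The product \<open>f u\<close> need not be a Schwartz function, because nothing is known about the growth of the
  derivatives of \<open>u\<close>.  Cutting it off makes it smooth with compact support and does not increase
  its absolute value, while the transforms converge pointwise; the estimate passes to
  the limit by Fatou's lemma.\<close>

lemma restriction_smooth_multiple:
  assumes restr: "restriction_estimate d p C" and "0 \<le> C" "1 \<le> p" and f: "schwartz d f"
    and u: "smooth d u" and bound: "\<And>x. x \<in> Rd d \<Longrightarrow> cmod (u x) \<le> B"
  shows "(\<integral>\<^sup>+y. ennreal ((cmod (fourier d (\<lambda>x. f x * u x) y))\<^sup>2) \<partial>sphere_measure d)
    \<le> ennreal (C\<^sup>2 * (\<integral>x. cmod (f x * u x) powr p \<partial>leb d) powr (2 / p))"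
proof -
  define \<kappa> where "\<kappa> n x = complex_of_real (cutoff d (real (Suc n)) x)" for n x
  define h where "h n x = f x * u x * \<kappa> n x" for n x
  note [measurable] = borel_measurable_integrable[OF schwartz_integrable[OF f]]
    borel_measurable_leb_of_continuous[OF smooth_continuous[OF u]]
  have \<kappa>: "smooth d (\<kappa> n)" for n unfolding \<kappa>_def by (intro smooth_cutoff) simp
  note [measurable] = borel_measurable_leb_of_continuous[OF smooth_continuous[OF \<kappa>]]
  have n\<kappa>: "cmod (\<kappa> n x) \<le> 1" for n x by (simp add: \<kappa>_def cutoff_nonneg cutoff_le_one)
  have fs: "smooth d f" using f by (simp add: schwartz_def)
  have h: "schwartz d (h n)" for n
  proof (rule schwartz_if_zero_outside_box[where R="real (Suc n)"])
    show "smooth d (h n)" unfolding h_def by (intro smooth_mult fs u \<kappa>)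
    show "h n x = 0" if "\<exists>i<d. real (Suc n) < \<bar>x i\<bar>" for x
      using that by (auto simp: h_def \<kappa>_def cutoff_eq_0)
  qed
  have hu: "cmod (h n x) \<le> cmod (f x * u x)" for n x
    unfolding h_def norm_mult using mult_left_mono[OF n\<kappa>[of n x], of "cmod (f x) * cmod (u x)"] by simp
  have int: "integrable (leb d) (\<lambda>x. f x * u x)"
    by (rule integrable_mult_bounded[OF schwartz_integrable[OF f] _ bound]) auto
  have intp: "integrable (leb d) (\<lambda>x. cmod (f x * u x) powr p)"
    unfolding norm_mult by (rule powr_mult_bounded_integrable[OF f \<open>1 \<le> p\<close>]) (auto intro: bound)
  have lim: "(\<lambda>n. fourier d (h n) y) \<longlonglongrightarrow> fourier d (\<lambda>x. f x * u x) y" for y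
    unfolding fourier_chr
  proof (rule integral_dominated_convergence[where w="\<lambda>x. cmod (f x * u x)"])
    show "(\<lambda>x. chr (dot d x y) * (f x * u x)) \<in> borel_measurable (leb d)"
      unfolding dot_def by measurable
    show "(\<lambda>x. chr (dot d x y) * h n x) \<in> borel_measurable (leb d)" for n
      unfolding dot_def h_def by measurable
    show "integrable (leb d) (\<lambda>x. cmod (f x * u x))" using int by simp
    show "AE x in leb d. (\<lambda>n. chr (dot d x y) * h n x) \<longlonglongrightarrow> chr (dot d x y) * (f x * u x)"
    proof (rule AE_I2)
      fix x
      have "(\<lambda>n. \<kappa> n x) \<longlonglongrightarrow> of_real 1"
        unfolding \<kappa>_def by (intro tendsto_of_real cutoff_tendsto)
      from tendsto_mult[OF tendsto_const this, of "chr (dot d x y) * (f x * u x)"]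
      show "(\<lambda>n. chr (dot d x y) * h n x) \<longlonglongrightarrow> chr (dot d x y) * (f x * u x)"
        by (simp add: h_def mult_ac)
    qed
    show "AE x in leb d. norm (chr (dot d x y) * h n x) \<le> cmod (f x * u x)" for n
      using hu by (simp add: norm_mult)
  qed
  have [measurable]: "h n \<in> borel_measurable (leb d)" for n unfolding h_def by measurable
  have J0: "0 \<le> (\<integral>x. cmod (h n x) powr p \<partial>leb d)" for n by (intro integral_nonneg_AE) auto
  have le: "(\<integral>\<^sup>+y. ennreal ((cmod (fourier d (h n) y))\<^sup>2) \<partial>sphere_measure d)
      \<le> ennreal (C\<^sup>2 * (\<integral>x. cmod (f x * u x) powr p \<partial>leb d) powr (2 / p))" for n
  proof -
    have "(\<integral>x. cmod (h n x) powr p \<partial>leb d) \<le> (\<integral>x. cmod (f x * u x) powr p \<partial>leb d)"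
      using \<open>1 \<le> p\<close> by (intro integral_mono schwartz_powr_integrable h intp powr_mono2 hu) auto
    then have "C\<^sup>2 * (\<integral>x. cmod (h n x) powr p \<partial>leb d) powr (2 / p)
        \<le> C\<^sup>2 * (\<integral>x. cmod (f x * u x) powr p \<partial>leb d) powr (2 / p)"
      using \<open>1 \<le> p\<close> J0 by (intro mult_left_mono powr_mono2) auto
    then show ?thesis
      using restriction_schwartz[OF assms(1-3) h[of n]] by (meson ennreal_leI order_trans)
  qed
  have "(\<integral>\<^sup>+y. ennreal ((cmod (fourier d (\<lambda>x. f x * u x) y))\<^sup>2) \<partial>sphere_measure d)
      = (\<integral>\<^sup>+y. liminf (\<lambda>n. ennreal ((cmod (fourier d (h n) y))\<^sup>2)) \<partial>sphere_measure d)"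
    by (intro nn_integral_cong lim_imp_Liminf[symmetric] tendsto_ennrealI tendsto_power tendsto_norm lim) simp
  also have "\<dots> \<le> liminf (\<lambda>n. \<integral>\<^sup>+y. ennreal ((cmod (fourier d (h n) y))\<^sup>2) \<partial>sphere_measure d)"
    by (intro nn_integral_liminf) measurable
  also have "\<dots> \<le> ennreal (C\<^sup>2 * (\<integral>x. cmod (f x * u x) powr p \<partial>leb d) powr (2 / p))"
    using Liminf_mono[OF always_eventually[OF allI[OF le]], of sequentially] by (simp add: Liminf_const)
  finally show ?thesis .
qed

section \<open>The maximal restriction estimate\<close>

lemma powr_superadditive:
  fixes x y p :: real
  assumes "0 \<le> x" "0 \<le> y" "1 \<le> p"
  shows "x powr p + y powr p \<le> (x + y) powr p"
proof -
  have split: "u powr p = u * u powr (p - 1)" if "0 \<le> u" for u :: real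
    using that powr_add[of u 1 "p - 1"] by (cases "u = 0") auto
  have "x powr p + y powr p \<le> x * (x + y) powr (p - 1) + y * (x + y) powr (p - 1)"
    unfolding split[OF assms(1)] split[OF assms(2)]
    using assms by (intro add_mono mult_left_mono powr_mono2) auto
  also have "\<dots> = (x + y) powr p" using assms split[of "x + y"] by (simp add: algebra_simps)
  finally show ?thesis .
qed

lemma fourier_sum:
  assumes "\<And>k. k \<in> K \<Longrightarrow> integrable (leb d) (h k)"
  shows "fourier d (\<lambda>x. \<Sum>k\<in>K. h k x) y = (\<Sum>k\<in>K. fourier d (h k) y)"
proof -
  have "integrable (leb d) (\<lambda>x. chr (dot d x y) * h k x)" if "k \<in> K" for k
  proof (rule Bochner_Integration.integrable_bound[OF assms[OF that]])
    note [measurable] = borel_measurable_integrable[OF assms[OF that]]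
    show "(\<lambda>x. chr (dot d x y) * h k x) \<in> borel_measurable (leb d)"
      unfolding dot_def by measurable
  qed (simp add: norm_mult)
  then show ?thesis unfolding fourier_chr by (simp add: sum_distrib_left)
qed

lemma smooth_sum: "finite K \<Longrightarrow> (\<And>k. k \<in> K \<Longrightarrow> smooth d (w k)) \<Longrightarrow> smooth d (\<lambda>x. \<Sum>k\<in>K. w k x)"
  by (induction K rule: finite_induct) (auto intro: smooth_const smooth_add)

text \<open>The maximal inequality for the partial sums of \<open>\<Sum>\<^sub>k f w\<^sub>k\<close> after the Fourier transform.  The
  quantity \<open>g i j = \<integral> (\<Sum>\<^sub>i\<^sub>\<le>\<^sub>k\<^sub><\<^sub>j |f w\<^sub>k|)\<^sup>p\<close> is superadditive because \<open>p \<ge> 1\<close>, and the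
  restriction estimate bounds the square integral of a block by \<open>C\<^sup>2 g\<^sup>2\<^sup>/\<^sup>p\<close>, where
  \<open>2 / p > 1\<close> because \<open>p < 2\<close>.  As the sum over \<open>k\<close> stands inside the \<open>L\<^sup>p\<close> norm,
  the pointwise variation bounds the total: \<open>g 0 n \<le> V\<^sup>p \<integral> |f|\<^sup>p\<close>.\<close>

theorem maximal_bounded_variation:
  fixes w :: "nat \<Rightarrow> (nat \<Rightarrow> real) \<Rightarrow> complex"
  assumes restr: "restriction_estimate d p C" and "0 \<le> C" and p: "1 \<le> p" "p < 2"
    and f: "schwartz d f"
    and w: "\<And>k. smooth d (w k)"
    and var: "\<And>n x. x \<in> Rd d \<Longrightarrow> (\<Sum>k<n. cmod (w k x)) \<le> V"
  shows "(\<integral>\<^sup>+y. (SUP k\<in>{0..n}. ennreal ((cmod (fourier d (\<lambda>x. f x * (\<Sum>j<k. w j x)) y))\<^sup>2)) \<partial>sphere_measure d)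
    \<le> ennreal (maximal_const (2 / p) * (C * V * (\<integral>x. cmod (f x) powr p \<partial>leb d) powr (1 / p))\<^sup>2)"
proof -
  define \<Phi> where "\<Phi> k = fourier d (\<lambda>x. f x * w k x)" for k
  define v where "v i j x = (\<Sum>k\<in>{i..<j}. cmod (w k x))" for i j x
  define g where "g i j = (\<integral>x. (cmod (f x) * v i j x) powr p \<partial>leb d)" for i j
  define J where "J = (\<integral>x. cmod (f x) powr p \<partial>leb d)"
  note fint = schwartz_integrable[OF f]
  note [measurable] = borel_measurable_integrable[OF fint]
    borel_measurable_leb_of_continuous[OF smooth_continuous[OF w]]
  have v0: "0 \<le> v i j x" for i j x unfolding v_def by (intro sum_nonneg) auto
  have vV: "v i j x \<le> V" if "x \<in> Rd d" for i j x
  proof -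
    have "v i j x \<le> (\<Sum>k<j. cmod (w k x))" unfolding v_def by (intro sum_mono2) auto
    also have "\<dots> \<le> V" by (rule var[OF that])
    finally show ?thesis .
  qed
  have V: "0 \<le> V" using var[of "\<lambda>i\<in>{..<d}. 0" 0] by (simp add: Rd_def)
  have [measurable]: "v i j \<in> borel_measurable (leb d)" for i j
    unfolding v_def by measurable
  have gint: "integrable (leb d) (\<lambda>x. (cmod (f x) * v i j x) powr p)" for i j
    by (rule powr_mult_bounded_integrable[OF f p(1) _ v0 vV]) auto
  have wV: "cmod (\<Sum>k\<in>{i..<j}. w k x) \<le> v i j x" for i j x
    unfolding v_def by (rule norm_sum)
  have wint: "integrable (leb d) (\<lambda>x. f x * w k x)" for k
  proof (rule integrable_mult_bounded[OF fint])
    show "cmod (w k x) \<le> V" if "x \<in> Rd d" for x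
      using vV[OF that, of k "Suc k"] by (simp add: v_def)
  qed measurable
  have sum_\<Phi>: "(\<Sum>k\<in>{i..<j}. \<Phi> k y) = fourier d (\<lambda>x. f x * (\<Sum>k\<in>{i..<j}. w k x)) y" for i j y
    using fourier_sum[of "{i..<j}" d "\<lambda>k x. f x * w k x" y] wint
    by (simp add: \<Phi>_def sum_distrib_left)
  have g0: "0 \<le> g i j" for i j unfolding g_def by (intro integral_nonneg_AE) auto
  have gV: "g i j \<le> V powr p * J" for i j
  proof -
    have "g i j \<le> (\<integral>x. V powr p * cmod (f x) powr p \<partial>leb d)"
      unfolding g_def
    proof (rule integral_mono[OF gint])
      show "integrable (leb d) (\<lambda>x. V powr p * cmod (f x) powr p)"
        using schwartz_powr_integrable[OF f p(1)] by simp
      fix x assume "x \<in> space (leb d)"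
      then have "v i j x powr p \<le> V powr p"
        using p v0 vV by (intro powr_mono2) (auto simp: space_leb)
      then show "(cmod (f x) * v i j x) powr p \<le> V powr p * cmod (f x) powr p"
        using mult_right_mono[of "v i j x powr p" "V powr p" "cmod (f x) powr p"]
        by (simp add: powr_mult mult.commute)
    qed
    then show ?thesis by (simp add: J_def)
  qed
  have super: "g i j + g j k \<le> g i k" if "i \<le> j" "j \<le> k" for i j k
  proof -
    have "v i k x = v i j x + v j k x" for x
      unfolding v_def using that by (simp add: sum.atLeastLessThan_concat)
    then have "(cmod (f x) * v i j x) powr p + (cmod (f x) * v j k x) powr p \<le> (cmod (f x) * v i k x) powr p" for x
      using powr_superadditive[of "cmod (f x) * v i j x" "cmod (f x) * v j k x" p] p v0
      by (simp add: distrib_left)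
    then show ?thesis
      unfolding g_def Bochner_Integration.integral_add[OF gint gint, symmetric]
      by (intro integral_mono Bochner_Integration.integrable_add gint)
  qed
  have bound: "(\<integral>\<^sup>+y. ennreal ((cmod (\<Sum>k\<in>{i..<j}. \<Phi> k y))\<^sup>2) \<partial>sphere_measure d)
      \<le> ennreal (C\<^sup>2 * g i j powr (2 / p))" for i j
  proof -
    let ?u = "\<lambda>x. \<Sum>k\<in>{i..<j}. w k x"
    have us: "smooth d ?u" by (intro smooth_sum w) simp
    have uV: "cmod (?u x) \<le> V" if "x \<in> Rd d" for x using wV vV[OF that] by (rule order_trans)
    have "(\<integral>x. cmod (f x * ?u x) powr p \<partial>leb d) \<le> g i j"
      unfolding g_def
    proof (rule integral_mono[OF _ gint])
      show "integrable (leb d) (\<lambda>x. cmod (f x * ?u x) powr p)"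
        unfolding norm_mult using borel_measurable_leb_of_continuous[OF smooth_continuous[OF us]]
        by (intro powr_mult_bounded_integrable[OF f p(1)]) (auto intro: uV)
      show "cmod (f x * ?u x) powr p \<le> (cmod (f x) * v i j x) powr p" for x
        using p wV by (intro powr_mono2) (auto simp: norm_mult mult_left_mono)
    qed
    then have "C\<^sup>2 * (\<integral>x. cmod (f x * ?u x) powr p \<partial>leb d) powr (2 / p) \<le> C\<^sup>2 * g i j powr (2 / p)"
      using p by (intro mult_left_mono powr_mono2 integral_nonneg_AE) auto
    then show ?thesis
      unfolding sum_\<Phi>
      using restriction_smooth_multiple[OF restr \<open>0 \<le> C\<close> p(1) f us uV] by (meson ennreal_leI order_trans)
  qed
  have \<alpha>: "1 < 2 / p" using p by simp
  have K: "0 \<le> maximal_const (2 / p)" using maximal_const[OF \<alpha>] by metis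
  have "\<Phi> k \<in> borel_measurable (sphere_measure d)" for k
  proof -
    have "\<Phi> k \<in> borel_measurable (leb d)" unfolding \<Phi>_def by measurable
    then show ?thesis using measurable_cong_sets[OF sets_sphere_measure refl] by blast
  qed
  from maximal_partial_sums[OF this \<alpha> zero_le_power2 g0 super bound, of 0 n]
  have "(\<integral>\<^sup>+y. (SUP k\<in>{0..n}. ennreal ((cmod (\<Sum>j\<in>{0..<k}. \<Phi> j y))\<^sup>2)) \<partial>sphere_measure d)
      \<le> ennreal (maximal_const (2 / p) * C\<^sup>2 * g 0 n powr (2 / p))" by simp
  also have "\<dots> \<le> ennreal (maximal_const (2 / p) * C\<^sup>2 * (V powr p * J) powr (2 / p))"
    using K p gV g0 by (intro ennreal_leI mult_left_mono powr_mono2) auto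
  also have "(V powr p * J) powr (2 / p) = (V * J powr (1 / p))\<^sup>2"
  proof -
    have "0 \<le> J" unfolding J_def by (intro integral_nonneg_AE) auto
    moreover have "(V powr p) powr (2 / p) = V\<^sup>2" using p V by (simp add: powr_powr)
    ultimately show ?thesis by (simp add: powr_mult square_powr)
  qed
  finally show ?thesis
    unfolding sum_\<Phi> lessThan_atLeast0 J_def[symmetric] by (simp add: power_mult_distrib mult_ac)
qed

text \<open>Continuity in the dilation parameter reduces the supremum over all \<open>t\<close> to finite grids.\<close>

lemma continuous_dilated_fourier:
  assumes m: "smooth d m" and bound: "\<And>t z. 0 \<le> t \<Longrightarrow> cmod (m (vscale d (- t) z)) \<le> B"
    and f: "integrable (leb d) f" and t: "t \<longlonglongrightarrow> t0" "\<And>n. 0 \<le> t n"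
  shows "(\<lambda>n. fourier d (\<lambda>z. f z * m (vscale d (- t n) z)) x)
    \<longlonglongrightarrow> fourier d (\<lambda>z. f z * m (vscale d (- t0) z)) x"
  unfolding fourier_chr
proof (rule integral_dominated_convergence[where w="\<lambda>z. cmod (f z) * B"])
  note [measurable] = borel_measurable_integrable[OF f]
    borel_measurable_leb_of_continuous[OF smooth_continuous[OF m]]
  show "(\<lambda>z. chr (dot d z x) * (f z * m (vscale d (- t0) z))) \<in> borel_measurable (leb d)"
    "(\<lambda>z. chr (dot d z x) * (f z * m (vscale d (- t n) z))) \<in> borel_measurable (leb d)" for n
    unfolding dot_def by measurable
  show "integrable (leb d) (\<lambda>z. cmod (f z) * B)" using f by simp
  show "AE z in leb d. norm (chr (dot d z x) * (f z * m (vscale d (- t n) z))) \<le> cmod (f z) * B" for n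
    using bound[OF t(2)] by (simp add: norm_mult mult_left_mono)
  show "AE z in leb d. (\<lambda>n. chr (dot d z x) * (f z * m (vscale d (- t n) z)))
      \<longlonglongrightarrow> chr (dot d z x) * (f z * m (vscale d (- t0) z))"
  proof (rule AE_I2)
    fix z
    have "isCont (\<lambda>u. m (vscale d u z)) (- t0)"
      using has_vector_derivative_ray[OF m] by (rule has_vector_derivative_continuous)
    then have "(\<lambda>n. m (vscale d (- t n) z)) \<longlonglongrightarrow> m (vscale d (- t0) z)"
      by (rule isCont_tendsto_compose) (intro tendsto_minus t)
    then show "(\<lambda>n. chr (dot d z x) * (f z * m (vscale d (- t n) z)))
      \<longlonglongrightarrow> chr (dot d z x) * (f z * m (vscale d (- t0) z))"
      by (intro tendsto_intros)
  qed
qed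

text \<open>The grid of all \<open>i / (n + 1)\<close> with \<open>i \<le> (n + 1)\<^sup>2\<close>, in decreasing order, as partial sums start
  from infinity, where the multiplier vanishes.  Truncated subtraction keeps the sequence at \<open>0\<close>
  once the grid is exhausted.\<close>

definition grid :: "nat \<Rightarrow> nat \<Rightarrow> real" where
  "grid n j = real ((n + 1)\<^sup>2 - j) / real (n + 1)"

lemma grid_nonneg: "0 \<le> grid n j"
  by (simp add: grid_def)

lemma grid_Suc_le: "grid n (Suc j) \<le> grid n j"
  by (simp add: grid_def divide_right_mono)

text \<open>Round \<open>t (n + 1)\<close> down; for \<open>n \<ge> t\<close> the result is at most \<open>(n + 1)\<^sup>2\<close>.\<close>

lemma grid_approximates:
  assumes "0 \<le> t"
  obtains k where "\<And>n. t \<le> real n \<Longrightarrow> k n \<le> (n + 1)\<^sup>2" "(\<lambda>n. grid n (k n)) \<longlonglongrightarrow> t"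
proof
  define l where "l n = nat \<lfloor>t * real (n + 1)\<rfloor>" for n
  define k where "k n = (n + 1)\<^sup>2 - l n" for n
  show "k n \<le> (n + 1)\<^sup>2" for n by (simp add: k_def)
  have l: "real (l n) \<le> t * real (n + 1)" "t * real (n + 1) - 1 \<le> real (l n)" for n
    unfolding l_def using assms by auto
  have g: "grid n (k n) = real (l n) / real (n + 1)" if "t \<le> real n" for n
  proof -
    have "real (l n) \<le> real n * real (n + 1)"
      using l(1)[of n] mult_right_mono[OF that, of "real (n + 1)"] by linarith
    also have "\<dots> \<le> real ((n + 1)\<^sup>2)" by (simp add: power2_eq_square algebra_simps)
    finally have "l n \<le> (n + 1)\<^sup>2" using of_nat_le_iff by blast
    then show ?thesis by (simp add: grid_def k_def)
  qed
  have "(\<lambda>n. real (l n) / real (n + 1)) \<longlonglongrightarrow> t"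
  proof (rule tendsto_sandwich)
    show "eventually (\<lambda>n. t - 1 / real (n + 1) \<le> real (l n) / real (n + 1)) sequentially"
    proof (intro always_eventually allI)
      fix n
      have "t - 1 / real (n + 1) = (t * real (n + 1) - 1) / real (n + 1)" by (simp add: field_simps)
      also have "\<dots> \<le> real (l n) / real (n + 1)" by (intro divide_right_mono l) simp
      finally show "t - 1 / real (n + 1) \<le> real (l n) / real (n + 1)" .
    qed
    show "eventually (\<lambda>n. real (l n) / real (n + 1) \<le> t) sequentially"
      using l(1) by (intro always_eventually allI) (simp add: field_simps)
    show "(\<lambda>n. t - 1 / real (n + 1)) \<longlonglongrightarrow> t"
      using tendsto_diff[OF tendsto_const LIMSEQ_Suc[OF lim_1_over_n], of t] by simp
  qed simp
  moreover have "eventually (\<lambda>n. real (l n) / real (n + 1) = grid n (k n)) sequentially"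
    using eventually_ge_at_top[of "nat \<lceil>t\<rceil>"]
    by eventually_elim (simp add: g nat_ceiling_le_eq)
  ultimately show "(\<lambda>n. grid n (k n)) \<longlonglongrightarrow> t" by (rule Lim_transform_eventually)
qed

lemma SUP_square_le:
  assumes "\<And>t. t \<in> T \<Longrightarrow> ennreal ((c t)\<^sup>2) \<le> L" "\<And>t. 0 \<le> c t"
  shows "enn_powr (SUP t\<in>T. ennreal (c t)) 2 \<le> L"
proof (cases L)
  case (real l)
  have "c t \<le> sqrt l" if "t \<in> T" for t
    using assms(1)[OF that] real by (intro real_le_rsqrt) (simp add: ennreal_le_iff)
  then have "(SUP t\<in>T. ennreal (c t)) \<le> ennreal (sqrt l)"
    by (intro SUP_least ennreal_leI)
  moreover obtain b where "(SUP t\<in>T. ennreal (c t)) = ennreal b" "0 \<le> b"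
    using calculation by (cases "SUP t\<in>T. ennreal (c t)") (auto simp: top_unique)
  ultimately have "enn_powr (SUP t\<in>T. ennreal (c t)) 2 = ennreal (b\<^sup>2)" "b \<le> sqrt l"
    using real by (auto simp: enn_powr_2 ennreal_le_iff)
  moreover have "b\<^sup>2 \<le> l"
    using power_mono[OF \<open>b \<le> sqrt l\<close> \<open>0 \<le> b\<close>, of 2] real by simp
  ultimately show ?thesis using real by (simp add: ennreal_leI)
qed simp

text \<open>On the grid of level \<open>n\<close> the increments \<open>w\<close> of \<open>t \<mapsto> m(-t z)\<close>, the first one counted from
  infinity, have pointwise variation at most \<open>D / \<eta>\<close>, and their partial sums are the values of the
  multiplier.  Every \<open>t > 0\<close> is a limit of grid points, so the full maximal function is below the
  lower limit of the discrete ones, and Fatou's lemma concludes.\<close>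

theorem maximal_restriction:
  assumes p: "1 \<le> p" "p < 2" and "0 < \<eta>" and "1 \<le> d"
    and mu: "complex_measure (leb d) \<mu>"
    and m: "smooth d (fourier_measure d \<mu>)" and "0 \<le> D"
    and grad: "\<And>x. x \<in> Rd d \<Longrightarrow> grad_norm d (fourier_measure d \<mu>) x \<le> D * (1 + enorm d x) powr (- 1 - \<eta>)"
    and decay: "\<And>e. 0 < e \<Longrightarrow> \<exists>r. \<forall>x\<in>Rd d. r \<le> enorm d x \<longrightarrow> cmod (fourier_measure d \<mu> x) < e"
    and "0 \<le> C" and restr: "restriction_estimate d p C" and f: "schwartz d f"
  shows "Lp_norm 2 (sphere_measure d)
      (\<lambda>x. SUP t\<in>{0<..}. ennreal (cmod (convolution d (fourier d f) (dilate d t \<mu>) x)))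
    \<le> ennreal (sqrt (maximal_const (2 / p)) / \<eta> * C * D) * Lp_norm p (leb d) (\<lambda>x. ennreal (cmod (f x)))"
proof -
  define m where "m = fourier_measure d \<mu>"
  define F where "F t x = fourier d (\<lambda>z. f z * m (vscale d (- t) z)) x" for t x
  define w where "w n j z = (case j of 0 \<Rightarrow> m (vscale d (- grid n 0) z)
    | Suc i \<Rightarrow> m (vscale d (- grid n (Suc i)) z) - m (vscale d (- grid n i) z))" for n j z
  define J where "J = (\<integral>x. cmod (f x) powr p \<partial>leb d)"
  define Q where "Q = maximal_const (2 / p) * (C * (D / \<eta>) * J powr (1 / p))\<^sup>2"
  define N :: "nat \<Rightarrow> nat" where "N n = Suc ((n + 1)\<^sup>2)" for n
  define M where "M n x = (SUP k\<in>{0..N n}. ennreal ((cmod (fourier d (\<lambda>z. f z * (\<Sum>j<k. w n j z)) x))\<^sup>2))" for n x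
  note m' = m[folded m_def] and grad' = grad[folded m_def] and decay' = decay[folded m_def]
  note fint = schwartz_integrable[OF f]
  note [measurable] = borel_measurable_integrable[OF fint]
  have ms: "smooth d (\<lambda>z. m (vscale d c z))" for c by (rule smooth_vscale[OF m'])
  have ws: "smooth d (w n j)" for n j
  proof (cases j)
    case 0
    then show ?thesis using ms by (simp add: w_def[abs_def])
  next
    case (Suc i)
    have "smooth d (\<lambda>z. m (vscale d (- grid n (Suc i)) z) + (- 1) * m (vscale d (- grid n i) z))"
      by (intro smooth_add smooth_mult smooth_const ms)
    with Suc show ?thesis by (simp add: w_def[abs_def])
  qed
  have w_sum: "(\<Sum>j<Suc k. w n j z) = m (vscale d (- grid n k) z)" for n k z
    by (induction k) (auto simp: w_def)
  have var: "(\<Sum>j<k. cmod (w n j z)) \<le> D / \<eta>" for n k z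
  proof (cases k)
    case 0
    then show ?thesis using \<open>0 < \<eta>\<close> \<open>0 \<le> D\<close> by simp
  next
    case (Suc i)
    have "(\<Sum>j<k. cmod (w n j z)) = cmod (m (vscale d (- grid n 0) z))
      + (\<Sum>j<i. cmod (m (vscale d (- grid n (Suc j)) z) - m (vscale d (- grid n j) z)))"
      unfolding Suc sum.lessThan_Suc_shift by (simp add: w_def)
    also have "\<dots> \<le> D / \<eta>"
      by (rule ray_variation[OF m' \<open>0 < \<eta>\<close> \<open>0 \<le> D\<close> \<open>1 \<le> d\<close> grad' decay']) (auto simp: grid_nonneg grid_Suc_le)
    finally show ?thesis .
  qed
  have m_bound: "cmod (m (vscale d (- t) z)) \<le> D / \<eta>" if "0 \<le> t" for t z
    using ray_variation[OF m' \<open>0 < \<eta>\<close> \<open>0 \<le> D\<close> \<open>1 \<le> d\<close> grad' decay', of "\<lambda>_. t" z 0] that by simp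
  have conv: "convolution d (fourier d f) (dilate d t \<mu>) x = F t x" if "0 < t" for t x
    unfolding F_def m_def by (rule convolution_dilate_eq_fourier[OF mu fint that])
  have M_meas: "M n \<in> borel_measurable (sphere_measure d)" for n
  proof -
    have [measurable]: "w n j \<in> borel_measurable (leb d)" for j
      by (rule borel_measurable_leb_of_continuous[OF smooth_continuous[OF ws]])
    have "fourier d (\<lambda>z. f z * (\<Sum>j<k. w n j z)) \<in> borel_measurable (sphere_measure d)" for k
    proof -
      have "fourier d (\<lambda>z. f z * (\<Sum>j<k. w n j z)) \<in> borel_measurable (leb d)" by measurable
      then show ?thesis using measurable_cong_sets[OF sets_sphere_measure refl] by blast
    qed
    then show ?thesis unfolding M_def by (intro borel_measurable_SUP) auto
  qed
  \<comment> \<open>Partial sums are indexed by their length, so the grid point \<open>k n\<close> belongs to \<open>Suc (k n)\<close>.\<close>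
  have point: "enn_powr (SUP t\<in>{0<..}. ennreal (cmod (convolution d (fourier d f) (dilate d t \<mu>) x))) 2
      \<le> liminf (\<lambda>n. M n x)" for x
  proof (rule SUP_square_le)
    fix t :: real assume "t \<in> {0<..}"
    then have t: "0 < t" by simp
    obtain k where k: "\<And>n. t \<le> real n \<Longrightarrow> k n \<le> (n + 1)\<^sup>2" and lim: "(\<lambda>n. grid n (k n)) \<longlonglongrightarrow> t"
      using grid_approximates[of t] t by (metis less_imp_le)
    have "(\<lambda>n. F (grid n (k n)) x) \<longlonglongrightarrow> F t x"
      unfolding F_def by (rule continuous_dilated_fourier[OF m' m_bound fint lim grid_nonneg])
    then have "liminf (\<lambda>n. ennreal ((cmod (F (grid n (k n)) x))\<^sup>2)) = ennreal ((cmod (F t x))\<^sup>2)"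
      by (intro lim_imp_Liminf tendsto_ennrealI tendsto_power tendsto_norm) simp
    moreover have "liminf (\<lambda>n. ennreal ((cmod (F (grid n (k n)) x))\<^sup>2)) \<le> liminf (\<lambda>n. M n x)"
    proof (rule Liminf_mono)
      show "eventually (\<lambda>n. ennreal ((cmod (F (grid n (k n)) x))\<^sup>2) \<le> M n x) sequentially"
        using eventually_ge_at_top[of "nat \<lceil>t\<rceil>"]
      proof eventually_elim
        case (elim n)
        then have "k n \<le> (n + 1)\<^sup>2" by (intro k) (simp add: nat_ceiling_le_eq)
        then have "Suc (k n) \<in> {0..N n}" by (simp add: N_def)
        moreover have "F (grid n (k n)) x = fourier d (\<lambda>z. f z * (\<Sum>j<Suc (k n). w n j z)) x"
          unfolding F_def w_sum ..
        ultimately show ?case unfolding M_def by (intro SUP_upper2[of "Suc (k n)"]) auto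
      qed
    qed
    ultimately show "ennreal ((cmod (convolution d (fourier d f) (dilate d t \<mu>) x))\<^sup>2) \<le> liminf (\<lambda>n. M n x)"
      using conv[OF t] by simp
  qed simp
  have "(\<integral>\<^sup>+x. enn_powr (SUP t\<in>{0<..}. ennreal (cmod (convolution d (fourier d f) (dilate d t \<mu>) x))) 2 \<partial>sphere_measure d)
      \<le> (\<integral>\<^sup>+x. liminf (\<lambda>n. M n x) \<partial>sphere_measure d)"
    by (intro nn_integral_mono point)
  also have "\<dots> \<le> liminf (\<lambda>n. \<integral>\<^sup>+x. M n x \<partial>sphere_measure d)"
    by (intro nn_integral_liminf M_meas)
  also have "\<dots> \<le> ennreal Q"
  proof -
    have "(\<integral>\<^sup>+x. M n x \<partial>sphere_measure d) \<le> ennreal Q" for n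
      unfolding M_def Q_def J_def
      by (rule maximal_bounded_variation[OF restr \<open>0 \<le> C\<close> p f ws var])
    then show ?thesis
      using Liminf_mono[OF always_eventually, of "\<lambda>n. \<integral>\<^sup>+x. M n x \<partial>sphere_measure d" "\<lambda>_. ennreal Q" sequentially]
      by (simp add: Liminf_const)
  qed
  finally have main: "(\<integral>\<^sup>+x. enn_powr (SUP t\<in>{0<..}. ennreal (cmod (convolution d (fourier d f) (dilate d t \<mu>) x))) 2 \<partial>sphere_measure d)
      \<le> ennreal Q" .
  have "1 < 2 / p" using p by simp
  then have K: "0 \<le> maximal_const (2 / p)" using maximal_const by metis
  define c where "c = sqrt (maximal_const (2 / p)) / \<eta> * C * D * J powr (1 / p)"
  have "0 \<le> c" unfolding c_def using K \<open>0 < \<eta>\<close> \<open>0 \<le> C\<close> \<open>0 \<le> D\<close> by simp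
  moreover have "Q = c\<^sup>2"
    unfolding Q_def c_def using K by (simp add: power_mult_distrib power_divide)
  ultimately have "Lp_norm 2 (sphere_measure d)
      (\<lambda>x. SUP t\<in>{0<..}. ennreal (cmod (convolution d (fourier d f) (dilate d t \<mu>) x))) \<le> ennreal c"
    unfolding Lp_norm_def using main by (simp add: enn_powr_half_le_iff)
  also have "ennreal c = ennreal (sqrt (maximal_const (2 / p)) / \<eta> * C * D) * Lp_norm p (leb d) (\<lambda>x. ennreal (cmod (f x)))"
    unfolding Lp_norm_cmod[OF schwartz_powr_integrable[OF f p(1)]] c_def J_def
    using K \<open>0 < \<eta>\<close> \<open>0 \<le> C\<close> \<open>0 \<le> D\<close> by (intro ennreal_mult) auto
  finally show ?thesis .
qed

theorem corollary3:
  fixes p \<eta> :: real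
  assumes "1 \<le> p" and "p \<le> 2" and "0 < \<eta>"
  shows "\<exists>C\<ge>0. \<forall>(d::nat) (\<mu> :: (nat \<Rightarrow> real) set \<Rightarrow> complex) (D::real) (Crestr::real).
    1 \<le> d \<longrightarrow>
    p \<le> 2 * (real d + 1) / (real d + 3) \<longrightarrow>
    complex_measure (leb d) \<mu> \<longrightarrow>
    smooth d (fourier_measure d \<mu>) \<longrightarrow>
    0 \<le> D \<longrightarrow>
    (\<forall>x\<in>Rd d. grad_norm d (fourier_measure d \<mu>) x \<le> D * (1 + enorm d x) powr (- 1 - \<eta>)) \<longrightarrow>
    (\<forall>e>0. \<exists>r. \<forall>x\<in>Rd d. r \<le> enorm d x \<longrightarrow> cmod (fourier_measure d \<mu> x) < e) \<longrightarrow>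
    0 \<le> Crestr \<longrightarrow>
    restriction_estimate d p Crestr \<longrightarrow>
    (\<forall>f. schwartz d f \<longrightarrow>
      Lp_norm 2 (sphere_measure d)
          (\<lambda>x. SUP t\<in>{0<..}. ennreal (cmod (convolution d (fourier d f) (dilate d t \<mu>) x)))
        \<le> ennreal (C * Crestr * D) * Lp_norm p (leb d) (\<lambda>x. ennreal (cmod (f x))))"
  \<comment> \<open>The bars make the witness nonnegative before \<open>p < 2\<close> is known.\<close>
proof (intro exI[of _ "\<bar>sqrt (maximal_const (2 / p)) / \<eta>\<bar>"] conjI allI impI)
  show "0 \<le> \<bar>sqrt (maximal_const (2 / p)) / \<eta>\<bar>" by simp
  fix d \<mu> D Crestr f
  assume d: "1 \<le> d" and pd: "p \<le> 2 * (real d + 1) / (real d + 3)"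
    and mu: "complex_measure (leb d) \<mu>" "smooth d (fourier_measure d \<mu>)" and D: "0 \<le> D"
    and grad: "\<forall>x\<in>Rd d. grad_norm d (fourier_measure d \<mu>) x \<le> D * (1 + enorm d x) powr (- 1 - \<eta>)"
    and decay: "\<forall>e>0. \<exists>r. \<forall>x\<in>Rd d. r \<le> enorm d x \<longrightarrow> cmod (fourier_measure d \<mu> x) < e"
    and C: "0 \<le> Crestr" "restriction_estimate d p Crestr" and f: "schwartz d f"
  have "2 * (real d + 1) / (real d + 3) < 2" by (simp add: field_simps)
  with pd have p: "p < 2" by linarith
  then have "1 < 2 / p" using assms(1) by simp
  then have "0 \<le> maximal_const (2 / p)" using maximal_const by metis
  then have abs: "\<bar>sqrt (maximal_const (2 / p)) / \<eta>\<bar> = sqrt (maximal_const (2 / p)) / \<eta>"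
    using assms(3) by simp
  show "Lp_norm 2 (sphere_measure d)
          (\<lambda>x. SUP t\<in>{0<..}. ennreal (cmod (convolution d (fourier d f) (dilate d t \<mu>) x)))
        \<le> ennreal (\<bar>sqrt (maximal_const (2 / p)) / \<eta>\<bar> * Crestr * D) * Lp_norm p (leb d) (\<lambda>x. ennreal (cmod (f x)))"
    unfolding abs
    using maximal_restriction[OF assms(1) p assms(3) d mu D _ _ C f] grad decay by blast
qed

end
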